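(* Assume there exists $\epsilon<\delta_\mathcal{U}$ such that $p$ is $\epsilon$-concentrated on $\mathbb{X}$. Then $$\lim_{n\to\infty}\mathbb{P}\left(d_I(\hat{\mathscr{D}}^\pi_n,\mathscr{R}_\mathbb{X})\le \operatorname{res}_f\mathcal{U}\right)=1 .$$
   Context: Cosheaves. Let $\mathbf{Int}$ be the category of (nonempty) connected open subsets of $\mathbb{R}$ ("open intervals") with inclusions. A pre-cosheaf is a functor $\mathscr{F}:\mathbf{Int}\to\mathbf{Set}$, with structure maps $\mathscr{F}[U\subset V]$. For $U=(a,b)$ and $\varepsilon\ge0$ let $U_\varepsilon=(a-\varepsilon,b+\varepsilon)$. An $\varepsilon$-interleaving between $\mathscr{F},\mathscr{G}$ consists of families of maps $\varphi_U:\mathscr{F}(U)\to\mathscr{G}(U_\varepsilon)$, $\psi_U:\mathscr{G}(U)\to\mathscr{F}(U_\varepsilon)$, natural with respect to inclusions, with $\psi_{U_\varepsilon}\circ\varphi_U=\mathscr{F}[U\subset U_{2\varepsilon}]$ and $\varphi_{U_\varepsilon}\circ\psi_U=\mathscr{G}[U\subset U_{2\varepsilon}]$ for all $U$; $d_I(\mathscr{F},\mathscr{G})$ is the infimum of all $\varepsilon$ for which an $\varepsilon$-interleaving exists. Spaces. $\mathbb{X}\subset\mathbb{R}^d$ is compact and locally path connected, $f:\mathbb{R}^d\to\mathbb{R}$ is continuous, and $(\mathbb{X},f|_\mathbb{X})$ is a constructible $\mathbb{R}$-space: there are $a_0<\dots<a_m$ in $\mathbb{R}$, locally path-connected spaces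 $\mathbb{V}_0,\dots,\mathbb{V}_m$, $\mathbb{E}_0,\dots,\mathbb{E}_{m-1}$ and continuous maps $\ell_i:\mathbb{E}_i\to\mathbb{V}_i$, $r_i:\mathbb{E}_i\to\mathbb{V}_{i+1}$ such that $\mathbb{X}$ is the quotient of $\coprod_i\mathbb{V}_i\times\{a_i\}\sqcup\coprod_i\mathbb{E}_i\times[a_i,a_{i+1}]$ by $(\ell_i(x),a_i)\sim(x,a_i)$, $(r_i(x),a_{i+1})\sim(x,a_{i+1})$ for $x\in\mathbb{E}_i$, with $f|_{\mathbb{X}}$ the projection to the second factor. $\mathscr{R}_\mathbb{X}$ is the Reeb cosheaf of $(\mathbb{X},f|_\mathbb{X})$: $\mathscr{R}_\mathbb{X}(U)=\pi_0(\mathbb{X}\cap f^{-1}(U))$ (path components). Cover. $\mathcal{U}$ is a nice cover of $\mathbb{R}$: an open cover by open intervals, all nonempty intersections contractible, and $\mathcal{U}_x=\{V\in\mathcal{U}:x\in V\}$ finite for every $x$. $\mathcal{U}'$ is the set of all intersections $\bigcap_{\alpha\in A}U_\alpha$ of families $\{U_\alpha\}_{\alpha\in A}\subset\mathcal{U}$. $\mathcal{I}_\mathcal{U}(U)=\bigcup_{x\in U}\bigcap_{V\in\mathcal{U}_x}V$. $\operatorname{res}_f\mathcal{U}=\max\{\operatorname{diam}V:V\in\mathcal{U},\ V\cap f(\mathbb{X})\neq\emptyset\}\in[0,+\infty]$ (unbounded intervals have infinite diameter). Thickenings and densities. $p:\mathbb{R}^d\to\mathbb{R}$ is a probability density function.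 For $\delta\ge 0$, $\mathbb{X}_\delta=\{y:\inf_{x\in\mathbb{X}}d(x,y)\le\delta\}$; $D_L=p^{-1}([L,+\infty))$; for open $V\subset\mathbb{R}$, $\mathbb{X}^V=\mathbb{X}\cap f^{-1}(V)$, $\mathbb{X}_\delta^V=\mathbb{X}_\delta\cap f^{-1}(V)$, $D_L^V=D_L\cap f^{-1}(V)$. $H_0$ is degree-$0$ singular homology with field coefficients; all maps are induced by inclusions. $p$ is $\epsilon$-concentrated on $\mathbb{X}$ if there are open intervals $I_1,I_2$ and $\delta>0$ with $\mathbb{X}\subset D_{L_1}\subset\mathbb{X}_\delta\subset D_{L_2}\subset\mathbb{X}_\epsilon$ for all $L_1\in I_1$, $L_2\in I_2$. The local $H_0$-critical value over $V$ is $\delta_V=\sup\{\delta: H_0(\mathbb{X}^V)\to H_0(\mathbb{X}^V_{\delta'})\text{ is an isomorphism for all }0\le\delta'\le\delta\}$, and $\delta_\mathcal{U}=\min_{V\in\mathcal{U}'}\delta_V$. A real number $L$ is $H_0$-regular over $V$ if there is $\nu>0$ such that $H_0(D^V_{e_2})\to H_0(D^V_{e_1})$ is an isomorphism for all $e_1<e_2$ in $(L-\nu,L+\nu)$; $(L-\nu,L+\nu)$ is then an $H_0$-regularity range of $L$ over $V$. Standing assumptions: $\delta_\mathcal{U}>0$; $p$ is tame (for each open $V$ the set of $L$ that are $H_0$-regular over $V$ is dense in $\mathbb{R}$). Choice of constants. Given the concentration hypothesis, $L_1,L_2,\delta_1,\delta_2$ are fixed with $\mathbb{X}\subset D_{L_1}\subset\mathbb{X}_{\delta_1}\subset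 D_{L_2}\subset\mathbb{X}_{\delta_2}$, $0<\delta_1<\delta_2<\delta_\mathcal{U}$, and $L_1,L_2$ $H_0$-regular over every $V\in\mathcal{U}'$; and $\varepsilon_1,\varepsilon_2>0$ are fixed so that $L_i\pm2\varepsilon_i$ lie in the $H_0$-regularity range of $L_i$ over $V$ for every $V\in\mathcal{U}'$, and $L_1-2\varepsilon_1>L_2+2\varepsilon_2$. Estimators. $X_1,\dots,X_n$ are i.i.d. with density $p$. $K:\mathbb{R}^d\to[0,1]$ is a kernel with support in the unit ball $B_1(0)$, smooth in $B_1(0)$, $\max K=K(0)=1$, $\int K=C_K\in(0,1)$; $K_r(x)=K(x/r)$; $\hat p(x)=\frac{1}{C_Knr^d}\sum_{i=1}^nK_r(x-X_i)$. $\hat D_L=\bigcup_{i:\hat p(X_i)\ge L}B_r(X_i)$ and $\hat D_L^V=\hat D_L\cap f^{-1}(V)$. "W.h.p." means with probability tending to $1$ as $n\to\infty$. The bandwidth $r=r(n)$ satisfies $nr^d\ge\max(C_{\varepsilon_1},C_{\varepsilon_2})\log n$, where $C_\varepsilon>0$ denotes a constant, independent of $L$ and $V$, such that $nr^d\ge C_\varepsilon\log n$ guarantees, for each fixed $L$ and open $V$, that w.h.p. $D^V_{L+2\varepsilon}\subset\hat D^V_{L+\varepsilon}\subset D^V_L\subset\hat D^V_{L-\varepsilon}\subset D^V_{L-2\varepsilon}$. The random cosheaf $\hat{\mathscr{D}}^\pi_n$ is given by $$\hat{\mathscr{D}}^\pi_n(U)=\operatorname{Im}\left(\pi_0\big(\hat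 D_{L_1+\varepsilon_1}^{\mathcal{I}_\mathcal{U}(U)}\big)\to\pi_0\big(\hat D_{L_2-\varepsilon_2}^{\mathcal{I}_\mathcal{U}(U)}\big)\right)$$ for each open interval $U$, with structure maps induced by inclusion. *)

theory Defs
  imports "HOL-Probability.Probability" "HOL-Homology.Homology"
begin

section \<open>Pre-cosheaves on the open intervals of the real line\<close>

definition open_interval :: "real set \<Rightarrow> bool" where
  "open_interval U \<longleftrightarrow> open U \<and> connected U \<and> U \<noteq> {}"

record 'v cosheaf_data =
  ob :: "real set \<Rightarrow> 'v set"
  mor :: "real set \<Rightarrow> real set \<Rightarrow> 'v \<Rightarrow> 'v"

definition precosheaf :: "'v cosheaf_data \<Rightarrow> bool" where
  "precosheaf F \<longleftrightarrow>
     (\<forall>U V. open_interval U \<longrightarrow> open_interval V \<longrightarrow> U \<subseteq> V \<longrightarrow> mor F U V \<in> ob F U \<rightarrow> ob F V) \<and>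
     (\<forall>U. open_interval U \<longrightarrow> (\<forall>x\<in>ob F U. mor F U U x = x)) \<and>
     (\<forall>U V W. open_interval U \<longrightarrow> open_interval V \<longrightarrow> open_interval W \<longrightarrow> U \<subseteq> V \<longrightarrow> V \<subseteq> W \<longrightarrow>
        (\<forall>x\<in>ob F U. mor F V W (mor F U V x) = mor F U W x))"

text \<open>The end points of an open interval may be infinite, so they are taken in the extended reals.\<close>

definition enlarge :: "real \<Rightarrow> real set \<Rightarrow> real set" where
  "enlarge \<epsilon> U = einterval ((INF u\<in>U. ereal u) - ereal \<epsilon>) ((SUP u\<in>U. ereal u) + ereal \<epsilon>)"

definition interleaved :: "real \<Rightarrow> 'v cosheaf_data \<Rightarrow> 'w cosheaf_data \<Rightarrow> bool" where
  "interleaved \<epsilon> F G \<longleftrightarrow>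
     (\<exists>\<phi> \<psi>.
        (\<forall>U. open_interval U \<longrightarrow>
             \<phi> U \<in> ob F U \<rightarrow> ob G (enlarge \<epsilon> U) \<and> \<psi> U \<in> ob G U \<rightarrow> ob F (enlarge \<epsilon> U)) \<and>
        (\<forall>U V. open_interval U \<longrightarrow> open_interval V \<longrightarrow> U \<subseteq> V \<longrightarrow>
             (\<forall>x\<in>ob F U. \<phi> V (mor F U V x) = mor G (enlarge \<epsilon> U) (enlarge \<epsilon> V) (\<phi> U x)) \<and>
             (\<forall>y\<in>ob G U. \<psi> V (mor G U V y) = mor F (enlarge \<epsilon> U) (enlarge \<epsilon> V) (\<psi> U y))) \<and>
        (\<forall>U. open_interval U \<longrightarrow>
             (\<forall>x\<in>ob F U. \<psi> (enlarge \<epsilon> U) (\<phi> U x) = mor F U (enlarge (2 * \<epsilon>) U) x) \<and>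
             (\<forall>y\<in>ob G U. \<phi> (enlarge \<epsilon> U) (\<psi> U y) = mor G U (enlarge (2 * \<epsilon>) U) y)))"

definition interleaving_dist :: "'v cosheaf_data \<Rightarrow> 'w cosheaf_data \<Rightarrow> ennreal" where
  "interleaving_dist F G = (INF \<epsilon>\<in>{\<epsilon>. 0 \<le> \<epsilon> \<and> interleaved \<epsilon> F G}. ennreal \<epsilon>)"

lemma enlarge_bounded_interval:
  assumes "a < b" shows "enlarge \<epsilon> {a<..<b} = {a - \<epsilon><..<b + \<epsilon>}"
proof -
  have "ereal ` {a<..<b} = {ereal a<..<ereal b}"
  proof (intro subset_antisym subsetI)
    fix x assume "x \<in> {ereal a<..<ereal b}"
    then show "x \<in> ereal ` {a<..<b}" by (cases x) auto
  qed auto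
  then have "(INF u\<in>{a<..<b}. ereal u) = ereal a" "(SUP u\<in>{a<..<b}. ereal u) = ereal b"
    using assms by simp_all
  then show ?thesis by (auto simp: enlarge_def einterval_def)
qed

lemma enlarge_UNIV: "enlarge \<epsilon> UNIV = UNIV"
proof -
  have "(INF u. ereal u) = -\<infinity>" by (rule ereal_bot) (rule INF_lower, simp)
  moreover have "(SUP u. ereal u) = \<infinity>" by (rule ereal_top) (rule SUP_upper, simp)
  ultimately show ?thesis by (simp add: enlarge_def einterval_def)
qed


section \<open>Path components and the Reeb cosheaf\<close>

definition pi0 :: "'a::topological_space set \<Rightarrow> 'a set set" where
  "pi0 S = path_component_set S ` S"

text \<open>For \<open>S \<subseteq> T\<close> and \<open>c \<in> pi0 S\<close>, this is the path component of \<open>T\<close> that contains \<open>c\<close>.\<close>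

definition pi0_incl :: "'a::topological_space set \<Rightarrow> 'a set \<Rightarrow> 'a set" where
  "pi0_incl T c = (\<Union>x\<in>c. path_component_set T x)"

definition over :: "'a set \<Rightarrow> ('a \<Rightarrow> real) \<Rightarrow> real set \<Rightarrow> 'a set" where
  "over S f V = S \<inter> f -` V"

definition reeb_cosheaf :: "'a::topological_space set \<Rightarrow> ('a \<Rightarrow> real) \<Rightarrow> 'a set cosheaf_data" where
  "reeb_cosheaf S f = \<lparr>ob = (\<lambda>U. pi0 (over S f U)), mor = (\<lambda>U V. pi0_incl (over S f V))\<rparr>"


section \<open>Covers\<close>

definition nice_cover :: "real set set \<Rightarrow> bool" where
  "nice_cover \<U> \<longleftrightarrow>
     (\<forall>V\<in>\<U>. open_interval V) \<and> \<Union>\<U> = UNIV \<and>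
     (\<forall>A\<subseteq>\<U>. A \<noteq> {} \<longrightarrow> \<Inter>A \<noteq> {} \<longrightarrow> contractible (\<Inter>A)) \<and>
     (\<forall>x. finite {V\<in>\<U>. x \<in> V})"

definition cover_intersections :: "real set set \<Rightarrow> real set set" where
  "cover_intersections \<U> = {\<Inter>A | A. A \<subseteq> \<U> \<and> A \<noteq> {}}"

definition cover_hull :: "real set set \<Rightarrow> real set \<Rightarrow> real set" where
  "cover_hull \<U> U = (\<Union>x\<in>U. \<Inter>{V\<in>\<U>. x \<in> V})"

text \<open>The library's \<open>diameter\<close> is \<open>0\<close> on unbounded sets; here it has to be infinite.\<close>

definition ediam :: "real set \<Rightarrow> ennreal" where
  "ediam V = (SUP x\<in>V. SUP y\<in>V. ennreal (dist x y))"

text \<open>For a nice cover and a nonempty compact \<open>S\<close> the supremum is attained: among the members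
  that meet the compact set \<open>f ` S\<close>, only finitely many are longer than any given
  positive length.  For \<open>S = {}\<close> its value is \<open>0\<close>.\<close>

definition cover_resolution :: "('a \<Rightarrow> real) \<Rightarrow> 'a set \<Rightarrow> real set set \<Rightarrow> ennreal" where
  "cover_resolution f S \<U> = (SUP V\<in>{V\<in>\<U>. V \<inter> f ` S \<noteq> {}}. ediam V)"

text \<open>The image of \<open>pi0 A \<rightarrow> pi0 B\<close> over the hulls of the intervals, for \<open>A \<subseteq> B\<close>.\<close>

definition image_cosheaf ::
    "'a::topological_space set \<Rightarrow> 'a set \<Rightarrow> ('a \<Rightarrow> real) \<Rightarrow> real set set \<Rightarrow> 'a set cosheaf_data" where
  "image_cosheaf A B f \<U> =
     \<lparr>ob = (\<lambda>U. pi0_incl (over B f (cover_hull \<U> U)) ` pi0 (over A f (cover_hull \<U> U))),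
      mor = (\<lambda>U V. pi0_incl (over B f (cover_hull \<U> V)))\<rparr>"

lemma pi0_incl_component:
  assumes "S \<subseteq> T" "x \<in> S"
  shows "pi0_incl T (path_component_set S x) = path_component_set T x"
proof -
  have *: "path_component_set T y = path_component_set T x" if "path_component S x y" for y
    using that assms(1) by (metis path_component_of_subset path_component_eq mem_Collect_eq)
  moreover have "path_component S x x" using assms by (simp add: path_component_refl)
  ultimately show ?thesis unfolding pi0_incl_def by blast
qed

lemma pi0_incl_image:
  assumes "S \<subseteq> T" shows "pi0_incl T ` pi0 S = path_component_set T ` S"
  using pi0_incl_component[OF assms] by (force simp: pi0_def image_image)

lemma over_mono: "A \<subseteq> B \<Longrightarrow> U \<subseteq> V \<Longrightarrow> over A f U \<subseteq> over B f V"
  by (auto simp: over_def)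

lemma cover_hull_mono: "U \<subseteq> V \<Longrightarrow> cover_hull \<U> U \<subseteq> cover_hull \<U> V"
  by (auto simp: cover_hull_def)

lemma precosheaf_image_cosheaf:
  assumes "A \<subseteq> B" shows "precosheaf (image_cosheaf A B f \<U>)"
proof -
  define I where "I = cover_hull \<U>"
  have I: "I U \<subseteq> I V" if "U \<subseteq> V" for U V
    using that by (simp add: I_def cover_hull_mono)
  have ob: "ob (image_cosheaf A B f \<U>) U = path_component_set (over B f (I U)) ` over A f (I U)" for U
    unfolding I_def by (simp add: image_cosheaf_def pi0_incl_image over_mono assms)
  have mor: "mor (image_cosheaf A B f \<U>) U V (path_component_set (over B f (I U)) x)
      = path_component_set (over B f (I V)) x" if "U \<subseteq> V" "x \<in> over A f (I U)" for U V x
    using pi0_incl_component[of "over B f (I U)" "over B f (I V)" x] that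
      over_mono[OF assms order_refl, of f "I U"] over_mono[OF order_refl I[OF that(1)], of B f]
    by (auto simp: image_cosheaf_def I_def)
  have sub: "x \<in> over A f (I V)" if "U \<subseteq> V" "x \<in> over A f (I U)" for U V x
    using that over_mono[OF order_refl I[OF that(1)], of A f] by blast
  show ?thesis
    unfolding precosheaf_def ob
  proof (intro conjI allI impI ballI Pi_I; elim imageE; hypsubst)
    fix U V x assume "U \<subseteq> V" "x \<in> over A f (I U)"
    then show "mor (image_cosheaf A B f \<U>) U V (path_component_set (over B f (I U)) x)
        \<in> path_component_set (over B f (I V)) ` over A f (I V)"
      using mor sub by blast
  next
    fix U x assume "x \<in> over A f (I U)"
    then show "mor (image_cosheaf A B f \<U>) U U (path_component_set (over B f (I U)) x)
        = path_component_set (over B f (I U)) x"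
      using mor by blast
  next
    fix U V W x assume "U \<subseteq> V" "V \<subseteq> W" "x \<in> over A f (I U)"
    then show "mor (image_cosheaf A B f \<U>) V W
          (mor (image_cosheaf A B f \<U>) U V (path_component_set (over B f (I U)) x))
        = mor (image_cosheaf A B f \<U>) U W (path_component_set (over B f (I U)) x)"
      using mor sub by (metis order_trans)
  qed
qed

lemma precosheaf_reeb_cosheaf: "precosheaf (reeb_cosheaf S f)"
proof -
  have "cover_hull {{x} | x. True} U = U" for U :: "real set"
    by (auto simp: cover_hull_def)
  moreover have "pi0_incl T ` pi0 T = pi0 T" for T :: "'a set"
    by (simp add: pi0_incl_image) (simp add: pi0_def)
  ultimately have "image_cosheaf S S f {{x} | x. True} = reeb_cosheaf S f"
    by (simp add: image_cosheaf_def reeb_cosheaf_def)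
  then show ?thesis using precosheaf_image_cosheaf[of S S f] by (metis order_refl)
qed


section \<open>Constructible spaces over the real line\<close>

text \<open>The disjoint union of the \<open>V i \<times> {a i}\<close>, tagged \<open>Inl i\<close>, and the
  \<open>E i \<times> [a i, a (i + 1)]\<close>, tagged \<open>Inr i\<close>.  Vertex and edge spaces share one type; this
  is no restriction, as a sum type holds both.\<close>

definition strata ::
    "nat \<Rightarrow> (nat \<Rightarrow> real) \<Rightarrow> (nat \<Rightarrow> 's topology) \<Rightarrow> (nat \<Rightarrow> 's topology)
      \<Rightarrow> ((nat + nat) \<times> 's \<times> real) topology" where
  "strata m a V E =
     sum_topology
       (\<lambda>t. case t of
              Inl i \<Rightarrow> prod_topology (V i) (top_of_set {a i})
            | Inr i \<Rightarrow> prod_topology (E i) (top_of_set {a i..a (Suc i)}))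
       (Inl ` {..m} \<union> Inr ` {..<m})"

inductive glue ::
    "nat \<Rightarrow> (nat \<Rightarrow> real) \<Rightarrow> (nat \<Rightarrow> 's topology) \<Rightarrow> (nat \<Rightarrow> 's \<Rightarrow> 's) \<Rightarrow> (nat \<Rightarrow> 's \<Rightarrow> 's)
      \<Rightarrow> (nat + nat) \<times> 's \<times> real \<Rightarrow> (nat + nat) \<times> 's \<times> real \<Rightarrow> bool"
  for m a E l r where
  left: "i < m \<Longrightarrow> x \<in> topspace (E i) \<Longrightarrow> glue m a E l r (Inl i, l i x, a i) (Inr i, x, a i)"
| right: "i < m \<Longrightarrow> x \<in> topspace (E i) \<Longrightarrow>
    glue m a E l r (Inl (Suc i), r i x, a (Suc i)) (Inr i, x, a (Suc i))"

text \<open>\<open>S\<close> is the quotient of the strata, via some quotient map \<open>q\<close> whose fibres are exactly the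
  classes of the equivalence relation generated by \<open>glue\<close>, and \<open>f\<close> is the projection to the
  real coordinate.\<close>

definition constructible ::
    "'a::topological_space set \<Rightarrow> ('a \<Rightarrow> real) \<Rightarrow> nat \<Rightarrow> (nat \<Rightarrow> real) \<Rightarrow> (nat \<Rightarrow> 's topology)
      \<Rightarrow> (nat \<Rightarrow> 's topology) \<Rightarrow> (nat \<Rightarrow> 's \<Rightarrow> 's) \<Rightarrow> (nat \<Rightarrow> 's \<Rightarrow> 's) \<Rightarrow> bool" where
  "constructible S f m a V E l r \<longleftrightarrow>
     (\<forall>i<m. a i < a (Suc i)) \<and>
     (\<forall>i\<le>m. locally_path_connected_space (V i)) \<and>
     (\<forall>i<m. locally_path_connected_space (E i)) \<and>
     (\<forall>i<m. continuous_map (E i) (V i) (l i) \<and> continuous_map (E i) (V (Suc i)) (r i)) \<and>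
     (\<exists>q. quotient_map (strata m a V E) (top_of_set S) q \<and>
          (\<forall>z\<in>topspace (strata m a V E). \<forall>z'\<in>topspace (strata m a V E).
             q z = q z' \<longleftrightarrow> equivclp (glue m a E l r) z z') \<and>
          (\<forall>z\<in>topspace (strata m a V E). f (q z) = snd (snd z)))"


section \<open>Singular homology with field coefficients\<close>

text \<open>The library's singular chains have integer coefficients; its singular simplices and faces
  are reused here.\<close>

definition fchains :: "nat \<Rightarrow> 'a topology \<Rightarrow> (((nat \<Rightarrow> real) \<Rightarrow> 'a) \<Rightarrow>\<^sub>0 'k::field) set" where
  "fchains p X = {c. Poly_Mapping.keys c \<subseteq> singular_simplex_set p X}"

definition fboundary ::
    "nat \<Rightarrow> (((nat \<Rightarrow> real) \<Rightarrow> 'a) \<Rightarrow>\<^sub>0 'k::field) \<Rightarrow> (((nat \<Rightarrow> real) \<Rightarrow> 'a) \<Rightarrow>\<^sub>0 'k)" where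
  "fboundary p c =
     (if p = 0 then 0
      else \<Sum>s\<in>Poly_Mapping.keys c. \<Sum>k\<le>p.
             Poly_Mapping.single (singular_face p k s) ((-1) ^ k * Poly_Mapping.lookup c s))"

definition fhomologous ::
    "nat \<Rightarrow> 'a topology \<Rightarrow>
      ((((nat \<Rightarrow> real) \<Rightarrow> 'a) \<Rightarrow>\<^sub>0 'k::field) \<times> (((nat \<Rightarrow> real) \<Rightarrow> 'a) \<Rightarrow>\<^sub>0 'k)) set" where
  "fhomologous p X =
     {(c, c'). c \<in> fchains p X \<and> fboundary p c = 0 \<and> c' \<in> fchains p X \<and> fboundary p c' = 0 \<and>
               c' - c \<in> fboundary (Suc p) ` fchains (Suc p) X}"

definition fhomology :: "nat \<Rightarrow> 'a topology \<Rightarrow> (((nat \<Rightarrow> real) \<Rightarrow> 'a) \<Rightarrow>\<^sub>0 'k::field) set set" where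
  "fhomology p X = {c \<in> fchains p X. fboundary p c = 0} // fhomologous p X"

text \<open>For \<open>S \<subseteq> T\<close>: the map \<open>H\<^sub>0(S; k) \<rightarrow> H\<^sub>0(T; k)\<close> induced by inclusion sends the class of a
  cycle in \<open>S\<close> to its class in \<open>T\<close>.  It is linear, so it is an isomorphism of vector spaces iff
  it is bijective.\<close>

definition H0_iso :: "'k::field itself \<Rightarrow> 'a::topological_space set \<Rightarrow> 'a set \<Rightarrow> bool" where
  "H0_iso k S T \<longleftrightarrow>
     bij_betw
       (\<lambda>h :: (((nat \<Rightarrow> real) \<Rightarrow> 'a) \<Rightarrow>\<^sub>0 'k) set. fhomologous 0 (top_of_set T) `` h)
       (fhomology 0 (top_of_set S)) (fhomology 0 (top_of_set T))"


section \<open>Thickenings, superlevel sets and regular values\<close>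

text \<open>Not written with \<open>infdist\<close>, since \<open>infdist y {} = 0\<close>, whereas the infimum over the empty
  set is infinite.\<close>

definition thickening :: "'a::metric_space set \<Rightarrow> real \<Rightarrow> 'a set" where
  "thickening S \<delta> = {y. (INF x\<in>S. ennreal (dist x y)) \<le> ennreal \<delta>}"

definition superlevel :: "('a \<Rightarrow> real) \<Rightarrow> real \<Rightarrow> 'a set" where
  "superlevel p L = p -` {L..}"

definition concentrated :: "('a::metric_space \<Rightarrow> real) \<Rightarrow> 'a set \<Rightarrow> real \<Rightarrow> bool" where
  "concentrated p S \<epsilon> \<longleftrightarrow>
     (\<exists>I1 I2 \<delta>. open_interval I1 \<and> open_interval I2 \<and> 0 < \<delta> \<and>
        (\<forall>L1\<in>I1. \<forall>L2\<in>I2.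
           S \<subseteq> superlevel p L1 \<and> superlevel p L1 \<subseteq> thickening S \<delta> \<and>
           thickening S \<delta> \<subseteq> superlevel p L2 \<and> superlevel p L2 \<subseteq> thickening S \<epsilon>))"

definition crit_value ::
    "'k::field itself \<Rightarrow> 'a::metric_space set \<Rightarrow> ('a \<Rightarrow> real) \<Rightarrow> real set \<Rightarrow> ennreal" where
  "crit_value k S f V =
     (SUP \<delta>\<in>{\<delta>. 0 \<le> \<delta> \<and> (\<forall>\<delta>'. 0 \<le> \<delta>' \<and> \<delta>' \<le> \<delta> \<longrightarrow> H0_iso k (over S f V) (over (thickening S \<delta>') f V))}.
        ennreal \<delta>)"

definition cover_crit_value ::
    "'k::field itself \<Rightarrow> 'a::metric_space set \<Rightarrow> ('a \<Rightarrow> real) \<Rightarrow> real set set \<Rightarrow> ennreal" where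
  "cover_crit_value k S f \<U> = (INF V\<in>cover_intersections \<U>. crit_value k S f V)"

text \<open>\<open>(L - \<nu>, L + \<nu>)\<close> is an \<open>H\<^sub>0\<close>-regularity range of \<open>L\<close> over \<open>V\<close>.\<close>

definition regularity_range ::
    "'k::field itself \<Rightarrow> ('a::topological_space \<Rightarrow> real) \<Rightarrow> ('a \<Rightarrow> real) \<Rightarrow> real set
      \<Rightarrow> real \<Rightarrow> real \<Rightarrow> bool" where
  "regularity_range k p f V L \<nu> \<longleftrightarrow>
     0 < \<nu> \<and>
     (\<forall>e1 e2. e1 \<in> {L - \<nu><..<L + \<nu>} \<and> e2 \<in> {L - \<nu><..<L + \<nu>} \<and> e1 < e2 \<longrightarrow>
        H0_iso k (over (superlevel p e2) f V) (over (superlevel p e1) f V))"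

definition regular_value ::
    "'k::field itself \<Rightarrow> ('a::topological_space \<Rightarrow> real) \<Rightarrow> ('a \<Rightarrow> real) \<Rightarrow> real set \<Rightarrow> real \<Rightarrow> bool"
  where
  "regular_value k p f V L \<longleftrightarrow> (\<exists>\<nu>. regularity_range k p f V L \<nu>)"

definition tame :: "'k::field itself \<Rightarrow> ('a::topological_space \<Rightarrow> real) \<Rightarrow> ('a \<Rightarrow> real) \<Rightarrow> bool" where
  "tame k p f \<longleftrightarrow> (\<forall>V. open V \<longrightarrow> closure {L. regular_value k p f V L} = UNIV)"


section \<open>Density estimation\<close>

definition prob_density :: "('a::euclidean_space \<Rightarrow> real) \<Rightarrow> bool" where
  "prob_density p \<longleftrightarrow>
     p \<in> borel_measurable borel \<and> (\<forall>x. 0 \<le> p x) \<and> (\<integral>\<^sup>+x. ennreal (p x) \<partial>lborel) = 1"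

text \<open>\<open>Ck_on k S g\<close>, for open \<open>S\<close>: \<open>g\<close> is \<open>k\<close> times continuously differentiable on \<open>S\<close>.\<close>

primrec Ck_on :: "nat \<Rightarrow> 'a::real_normed_vector set \<Rightarrow> ('a \<Rightarrow> real) \<Rightarrow> bool" where
  "Ck_on 0 S g \<longleftrightarrow> continuous_on S g"
| "Ck_on (Suc k) S g \<longleftrightarrow>
     (\<exists>g'. (\<forall>x\<in>S. (g has_derivative g' x) (at x)) \<and> (\<forall>v. Ck_on k S (\<lambda>x. g' x v)))"

text \<open>A kernel as below is smooth in the open unit ball and vanishes off the closed one, hence is
  Lebesgue measurable and integrable.\<close>

definition kernel_mass :: "('a::euclidean_space \<Rightarrow> real) \<Rightarrow> real" where
  "kernel_mass K = integral\<^sup>L lebesgue K"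

definition kernel_function :: "('a::euclidean_space \<Rightarrow> real) \<Rightarrow> bool" where
  "kernel_function K \<longleftrightarrow>
     range K \<subseteq> {0..1} \<and> K 0 = 1 \<and> {x. K x \<noteq> 0} \<subseteq> cball 0 1 \<and> (\<forall>k. Ck_on k (ball 0 1) K) \<and>
     0 < kernel_mass K \<and> kernel_mass K < 1"

definition density_est ::
    "('a::euclidean_space \<Rightarrow> real) \<Rightarrow> nat \<Rightarrow> real \<Rightarrow> (nat \<Rightarrow> 'a) \<Rightarrow> 'a \<Rightarrow> real" where
  "density_est K n r X x =
     (\<Sum>i<n. K ((x - X i) /\<^sub>R r)) / (kernel_mass K * real n * r ^ DIM('a))"

definition superlevel_est ::
    "('a::euclidean_space \<Rightarrow> real) \<Rightarrow> nat \<Rightarrow> real \<Rightarrow> (nat \<Rightarrow> 'a) \<Rightarrow> real \<Rightarrow> 'a set" where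
  "superlevel_est K n r X L = (\<Union>i\<in>{i. i < n \<and> L \<le> density_est K n r X (X i)}. ball (X i) r)"

lemma superlevel_est_antimono: "L \<le> L' \<Longrightarrow> superlevel_est K n r X L' \<subseteq> superlevel_est K n r X L"
  unfolding superlevel_est_def by force

text \<open>The probability of an event that need not be known to be measurable: the supremum of the
  probabilities of the measurable events contained in it.\<close>

definition inner_prob :: "'w measure \<Rightarrow> 'w set \<Rightarrow> real" where
  "inner_prob M A = (SUP B\<in>{B\<in>sets M. B \<subseteq> A}. measure M B)"

lemma inner_prob_measurable:
  assumes "prob_space M" "A \<in> sets M" shows "inner_prob M A = measure M A"
proof -
  interpret prob_space M by fact
  show ?thesis unfolding inner_prob_def
    by (rule cSup_eq_maximum) (use assms(2) in \<open>auto intro: finite_measure_mono\<close>)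
qed

definition whp :: "'w measure \<Rightarrow> (nat \<Rightarrow> 'w \<Rightarrow> bool) \<Rightarrow> bool" where
  "whp M Q \<longleftrightarrow> (\<lambda>n. inner_prob M {\<omega>\<in>space M. Q n \<omega>}) \<longlonglongrightarrow> 1"

text \<open>\<open>C\<close> is a constant for which \<open>n r\<^sup>d \<ge> C log n\<close> guarantees the inclusions at level
  \<open>L\<close> with margin \<open>\<epsilon>\<close>, for the bandwidth sequence \<open>r\<close> at hand.  Neither the level nor the
  bandwidth is quantified here: the inclusions fail for every \<open>L \<le> 0\<close> (a finite union of
  balls does not cover the whole space), and a bandwidth that does not tend to \<open>0\<close> may
  satisfy \<open>n r\<^sup>d \<ge> C log n\<close> without the inclusions.\<close>

definition bandwidth_constant ::
    "'w measure \<Rightarrow> (nat \<Rightarrow> 'w \<Rightarrow> 'a::euclidean_space) \<Rightarrow> ('a \<Rightarrow> real) \<Rightarrow> ('a \<Rightarrow> real)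
      \<Rightarrow> ('a \<Rightarrow> real) \<Rightarrow> (nat \<Rightarrow> real) \<Rightarrow> real \<Rightarrow> real \<Rightarrow> real \<Rightarrow> bool" where
  "bandwidth_constant M X p f K r L \<epsilon> C \<longleftrightarrow>
     0 < C \<and>
     ((\<forall>\<^sub>F n in sequentially. C * ln (real n) \<le> real n * r n ^ DIM('a)) \<longrightarrow>
      (\<forall>V. open V \<longrightarrow>
         whp M (\<lambda>n \<omega>.
           let D = (\<lambda>e. over (superlevel p e) f V);
               D_est = (\<lambda>e. over (superlevel_est K n (r n) (\<lambda>i. X i \<omega>) e) f V)
           in D (L + 2 * \<epsilon>) \<subseteq> D_est (L + \<epsilon>) \<and> D_est (L + \<epsilon>) \<subseteq> D L \<and>
              D L \<subseteq> D_est (L - \<epsilon>) \<and> D_est (L - \<epsilon>) \<subseteq> D (L - 2 * \<epsilon>))))"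

end

theory Submission
  imports Defs
begin

text \<open>
  An isomorphism on degree-zero homology is a bijection on path components: the sum of the
  coefficients of a chain over a fixed path component is a homology invariant.  Injectivity of
  \<open>\<pi>\<^sub>0(S\<^sup>V) \<rightarrow> \<pi>\<^sub>0(T\<^sup>V)\<close> passes from the members of an open family \<open>V\<close> to their union, provided
  that surjectivity holds over the pairwise intersections: along a path in \<open>T\<close> the component of
  \<open>S\<close> attached to the current point is locally constant.

  On the high-probability event the estimator sets \<open>A \<subseteq> B\<close> satisfy
  \<open>D\<^bsub>L1+2\<epsilon>1\<^esub> \<subseteq> A \<subseteq> D\<^bsub>L1\<^esub> \<subseteq> S\<^bsub>\<delta>1\<^esub> \<subseteq> D\<^bsub>L2\<^esub> \<subseteq> B \<subseteq> D\<^bsub>L2-2\<epsilon>2\<^esub>\<close>, so that over every hull \<open>I(U)\<close> the image of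
  \<open>\<pi>\<^sub>0(A) \<rightarrow> \<pi>\<^sub>0(B)\<close> is identified with \<open>\<pi>\<^sub>0(S \<inter> f\<^sup>-\<^sup>1(I(U)))\<close>.  As \<open>U \<subseteq> I(U)\<close>, and
  \<open>I(U) \<inter> f(S)\<close> lies within the resolution of \<open>U\<close>, inclusions give the interleaving.
\<close>

section \<open>Zeroth homology and path components\<close>

text \<open>For \<open>S \<subseteq> T\<close>, this and \<open>pi0_inj\<close> say that the map on
  path components induced by inclusion is onto, respectively one-to-one. Stating them by points
  avoids handling component sets.\<close>

definition pi0_surj :: "'a::topological_space set \<Rightarrow> 'a set \<Rightarrow> bool" where
  "pi0_surj S T \<longleftrightarrow> (\<forall>y\<in>T. \<exists>x\<in>S. path_component T y x)"

definition pi0_inj :: "'a::topological_space set \<Rightarrow> 'a set \<Rightarrow> bool" where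
  "pi0_inj S T \<longleftrightarrow> (\<forall>x\<in>S. \<forall>y\<in>S. path_component T x y \<longrightarrow> path_component S x y)"

text \<open>Every path in \<open>R\<close> is a path in \<open>T\<close>. This is how injectivity
  reaches a set that is only known to lie inside a given one.\<close>

lemma pi0_inj_subset:
  assumes "pi0_inj S T" "R \<subseteq> T" shows "pi0_inj S R"
  using assms unfolding pi0_inj_def by (meson path_component_of_subset)

lemma pi0_inj_trans:
  assumes "pi0_inj R S" "pi0_inj S T" "R \<subseteq> S" shows "pi0_inj R T"
  using assms unfolding pi0_inj_def by blast

lemma pi0_surj_trans:
  assumes "pi0_surj R S" "pi0_surj S T" "S \<subseteq> T" shows "pi0_surj R T"
  using assms unfolding pi0_surj_def by (meson path_component_of_subset path_component_trans)

section \<open>Additivity of the boundary and the homology relation\<close>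

text \<open>Cancellation can shrink the keys of \<open>a + b\<close>, so all three sums are first
  extended to the union of the keys of \<open>a\<close> and \<open>b\<close>, where the added terms
  vanish. Serves both the boundary and the augmentation.\<close>

lemma sum_keys_add:
  fixes a b :: "'x \<Rightarrow>\<^sub>0 'k::comm_monoid_add" and h :: "'x \<Rightarrow> 'k \<Rightarrow> 'b::comm_monoid_add"
  assumes "\<And>s. h s 0 = 0" "\<And>s u v. h s (u + v) = h s u + h s v"
  shows "(\<Sum>s\<in>Poly_Mapping.keys (a + b). h s (Poly_Mapping.lookup (a + b) s)) =
    (\<Sum>s\<in>Poly_Mapping.keys a. h s (Poly_Mapping.lookup a s)) +
    (\<Sum>s\<in>Poly_Mapping.keys b. h s (Poly_Mapping.lookup b s))"
proof -
  let ?A = "Poly_Mapping.keys a \<union> Poly_Mapping.keys b"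
  have *: "(\<Sum>s\<in>Poly_Mapping.keys c. h s (Poly_Mapping.lookup c s)) = (\<Sum>s\<in>?A. h s (Poly_Mapping.lookup c s))"
    if "Poly_Mapping.keys c \<subseteq> ?A" for c
    by (rule sum.mono_neutral_left) (use that assms(1) in \<open>auto simp: in_keys_iff\<close>)
  show ?thesis
    unfolding *[OF Poly_Mapping.keys_add] *[OF Un_upper1] *[OF Un_upper2]
    by (simp add: lookup_add assms(2) sum.distrib)
qed

lemma fboundary_add: "fboundary p (a + b) = fboundary p a + fboundary p b"
proof (cases "p = 0")
  case False
  then show ?thesis
    unfolding fboundary_def
    by (simp, subst sum_keys_add) (simp_all add: single_add sum.distrib ring_distribs)
qed (simp add: fboundary_def)

lemma fboundary_0 [simp]: "fboundary p 0 = 0"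
  by (simp add: fboundary_def)

lemma fboundary_uminus: "fboundary p (- a) = - fboundary p a"
  using fboundary_add[of p a "- a"] by (simp add: eq_neg_iff_add_eq_0 add.commute)

text \<open>Boundaries contain 0 and are closed under negation and addition, which gives
  reflexivity, symmetry and transitivity in turn.\<close>

lemma equiv_fhomologous:
  "equiv {c \<in> fchains p X. fboundary p c = 0} (fhomologous p X)"
proof (rule equivI)
  show "fhomologous p X \<subseteq> {c \<in> fchains p X. fboundary p c = 0} \<times> {c \<in> fchains p X. fboundary p c = 0}"
    by (auto simp: fhomologous_def)
  have zero: "0 \<in> fboundary (Suc p) ` fchains (Suc p) X"
    by (rule image_eqI[where x = 0]) (auto simp: fchains_def)
  then show "refl_on {c \<in> fchains p X. fboundary p c = 0} (fhomologous p X)"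
    by (auto simp: refl_on_def fhomologous_def)
  show "sym (fhomologous p X)"
  proof (rule symI)
    fix c c' assume *: "(c, c') \<in> fhomologous p X"
    then obtain e where e: "e \<in> fchains (Suc p) X" "c' - c = fboundary (Suc p) e"
      by (auto simp: fhomologous_def)
    have "- e \<in> fchains (Suc p) X"
      using e(1) by (simp add: fchains_def)
    moreover have "c - c' = fboundary (Suc p) (- e)"
      unfolding fboundary_uminus e(2)[symmetric] by simp
    ultimately show "(c', c) \<in> fhomologous p X"
      using * by (auto simp: fhomologous_def)
  qed
  show "trans (fhomologous p X)"
  proof (rule transI)
    fix c c' c'' assume *: "(c, c') \<in> fhomologous p X" "(c', c'') \<in> fhomologous p X"
    then obtain e e' where e: "e \<in> fchains (Suc p) X" "c' - c = fboundary (Suc p) e"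
        "e' \<in> fchains (Suc p) X" "c'' - c' = fboundary (Suc p) e'"
      by (auto simp: fhomologous_def)
    have "e + e' \<in> fchains (Suc p) X"
      using e(1,3) Poly_Mapping.keys_add[of e e'] by (auto simp: fchains_def)
    moreover have "c'' - c = fboundary (Suc p) (e + e')"
      unfolding fboundary_add e(2)[symmetric] e(4)[symmetric] by simp
    ultimately show "(c, c'') \<in> fhomologous p X"
      using * by (auto simp: fhomologous_def)
  qed
qed

section \<open>Point simplices and the augmentation over a path component\<close>

definition vertex0 :: "nat \<Rightarrow> real" where
  "vertex0 = (\<lambda>j. if j = 0 then 1 else 0)"

lemma standard_simplex_0_vertex: "standard_simplex 0 = {vertex0}"
  by (simp add: standard_simplex_0 vertex0_def)

text \<open>Restricted because singular simplices are extensional on the standard simplex.\<close>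

definition point_simplex :: "'a \<Rightarrow> (nat \<Rightarrow> real) \<Rightarrow> 'a" where
  "point_simplex x = restrict (\<lambda>_. x) (standard_simplex 0)"

lemma singular_simplex_point: "x \<in> topspace X \<Longrightarrow> singular_simplex 0 X (point_simplex x)"
  by (auto simp: singular_simplex_def point_simplex_def)

lemma singular_simplex_0_vertex: "singular_simplex 0 X s \<Longrightarrow> s vertex0 \<in> topspace X"
  unfolding singular_simplex_def by (auto simp: continuous_map standard_simplex_0_vertex)

text \<open>The augmentation of degree-zero chains, counting only simplices located in
  \<open>P\<close>. For \<open>P\<close> a path component it is the coordinate of the homology class
  at that component.\<close>

definition component_augmentation ::
    "'a set \<Rightarrow> (((nat \<Rightarrow> real) \<Rightarrow> 'a) \<Rightarrow>\<^sub>0 'k::field) \<Rightarrow> 'k" where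
  "component_augmentation P c =
     (\<Sum>s\<in>Poly_Mapping.keys c. if s vertex0 \<in> P then Poly_Mapping.lookup c s else 0)"

lemma component_augmentation_add:
  "component_augmentation P (a + b) = component_augmentation P a + component_augmentation P b"
  unfolding component_augmentation_def by (rule sum_keys_add) auto

lemma component_augmentation_0 [simp]: "component_augmentation P 0 = 0"
  by (simp add: component_augmentation_def)

lemma component_augmentation_diff:
  "component_augmentation P (a - b) = component_augmentation P a - component_augmentation P b"
  using component_augmentation_add[of P "a - b" b] by simp

lemma component_augmentation_sum:
  "component_augmentation P (\<Sum>i\<in>I. g i) = (\<Sum>i\<in>I. component_augmentation P (g i))"
  by (induction I rule: infinite_finite_induct) (auto simp: component_augmentation_add)

lemma component_augmentation_single:
  "component_augmentation P (Poly_Mapping.single s v) = (if s vertex0 \<in> P then v else 0)"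
  by (auto simp: component_augmentation_def)

lemma singular_simplex_1_path_component:
  assumes "singular_simplex 1 (top_of_set T) s"
  shows "path_component T (singular_face 1 0 s vertex0) (singular_face 1 1 s vertex0)"
proof -
  let ?D = "standard_simplex 1"
  have "continuous_map (subtopology (powertop_real UNIV) ?D) (top_of_set T) s"
    using assms by (simp add: singular_simplex_def)
  moreover have "path_connectedin (subtopology (powertop_real UNIV) ?D) ?D"
    by (simp add: path_connectedin_subtopology path_connectedin_standard_simplex)
  ultimately have "path_connectedin (top_of_set T) (s ` ?D)"
    by (rule path_connectedin_continuous_map_image)
  then have *: "path_connected (s ` ?D)" "s ` ?D \<subseteq> T"
    by (auto simp: path_connectedin_subtopology)
  have "singular_face 1 j s vertex0 \<in> s ` ?D" if "j \<le> 1" for j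
    using that simplical_face_in_standard_simplex[of 1 j vertex0]
    by (auto simp: singular_face_def standard_simplex_0_vertex)
  then show ?thesis
    using * by (meson path_connected_component path_component_of_subset le_refl zero_le_one)
qed

text \<open>Both ends of each 1-simplex are joined in \<open>T\<close>, so they lie together inside
  or outside \<open>P\<close>, and they enter the boundary with opposite signs.\<close>

lemma component_augmentation_boundary:
  assumes "c \<in> fchains 1 (top_of_set T)" "\<And>x y. path_component T x y \<Longrightarrow> x \<in> P \<longleftrightarrow> y \<in> P"
  shows "component_augmentation P (fboundary 1 c) = 0"
proof -
  have "(singular_face 1 0 s vertex0 \<in> P) = (singular_face 1 1 s vertex0 \<in> P)"
    if "s \<in> Poly_Mapping.keys c" for s
    using that assms singular_simplex_1_path_component[of T s] by (auto simp: fchains_def)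
  then show ?thesis
    by (auto simp: fboundary_def component_augmentation_sum component_augmentation_add
        component_augmentation_single intro!: sum.neutral)
qed

lemma component_augmentation_homologous:
  assumes "(c, c') \<in> fhomologous 0 (top_of_set T)"
  shows "component_augmentation (path_component_set T y) c = component_augmentation (path_component_set T y) c'"
proof -
  obtain e where e: "e \<in> fchains 1 (top_of_set T)" "c' - c = fboundary 1 e"
    using assms by (auto simp: fhomologous_def)
  have "component_augmentation (path_component_set T y) (c' - c) = 0"
    unfolding e(2) using e(1)
    by (rule component_augmentation_boundary) (auto intro: path_component_trans path_component_sym)
  then show ?thesis by (simp add: component_augmentation_diff)
qed

lemma point_homologous:
  assumes "path_component T x y"
  shows "(Poly_Mapping.single (point_simplex x) (1::'k::field), Poly_Mapping.single (point_simplex y) 1)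
    \<in> fhomologous 0 (top_of_set T)"
proof -
  obtain g where g: "path g" "path_image g \<subseteq> T" "pathstart g = x" "pathfinish g = y"
    using assms by (auto simp: path_component_def)
  have xy: "x \<in> T" "y \<in> T" using assms path_component_mem by auto
  \<comment> \<open>The coordinate of index 1 maps the standard 1-simplex to the unit interval;
    composing with it turns \<open>g\<close> into a 1-simplex.\<close>
  define s where "s = restrict (\<lambda>z. g (z (1::nat))) (standard_simplex 1)"
  have "continuous_map (subtopology (powertop_real UNIV) (standard_simplex 1)) (top_of_set {0..1}) (\<lambda>z. z 1)"
    by (auto simp: continuous_map_in_subtopology standard_simplex_def
        intro: continuous_map_from_subtopology continuous_map_product_projection)
  moreover have "continuous_map (top_of_set {0..1}) (top_of_set T) g"
    using g by (auto simp: path_def path_image_def)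
  ultimately have "continuous_map (subtopology (powertop_real UNIV) (standard_simplex 1)) (top_of_set T)
      (g \<circ> (\<lambda>z. z 1))"
    by (rule continuous_map_compose)
  then have s: "singular_simplex 1 (top_of_set T) s"
    unfolding singular_simplex_def s_def
    by (auto intro: continuous_map_eq)
  have face: "singular_face 1 j s = point_simplex (g (simplical_face j vertex0 1))" if "j \<le> 1" for j
    using that simplical_face_in_standard_simplex[of 1 j vertex0]
    by (auto simp: singular_face_def point_simplex_def standard_simplex_0_vertex s_def
        intro!: restrict_ext)
  \<comment> \<open>Face 0 omits vertex 0 and sits at the end \<open>y\<close> of the path, face 1
    at its start \<open>x\<close>; hence the sign of the boundary.\<close>
  have "singular_face 1 0 s = point_simplex y" "singular_face 1 1 s = point_simplex x"
    using g face[of 0] face[of 1]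
    by (simp_all add: simplical_face_def vertex0_def pathstart_def pathfinish_def)
  then have "fboundary 1 (Poly_Mapping.single s (1::'k)) =
      Poly_Mapping.single (point_simplex y) 1 - Poly_Mapping.single (point_simplex x) 1"
    by (simp add: fboundary_def single_uminus)
  moreover have "Poly_Mapping.single s (1::'k) \<in> fchains 1 (top_of_set T)"
    using s by (auto simp: fchains_def)
  ultimately have "Poly_Mapping.single (point_simplex y) 1 - Poly_Mapping.single (point_simplex x) 1
      \<in> fboundary (Suc 0) ` (fchains (Suc 0) (top_of_set T) :: (_ \<Rightarrow>\<^sub>0 'k) set)"
    by (metis One_nat_def image_eqI)
  then show ?thesis
    using xy singular_simplex_point[of _ "top_of_set T"]
    by (simp add: fhomologous_def fchains_def fboundary_def[of 0])
qed

lemma fhomologous_mono: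
  assumes "S \<subseteq> T"
  shows "fhomologous p (top_of_set S) \<subseteq> fhomologous p (top_of_set T)"
proof -
  have "singular_simplex q (top_of_set T) s" if "singular_simplex q (top_of_set S) s" for q s
    using that assms continuous_map_into_fulltopology
    by (auto simp: singular_simplex_def continuous_map_in_subtopology)
  then have *: "fchains q (top_of_set S) \<subseteq> fchains q (top_of_set T)" for q
    by (auto simp: fchains_def)
  show ?thesis
    using *[of p] image_mono[OF *[of "Suc p"], of "fboundary (Suc p)"]
    by (auto simp: fhomologous_def)
qed

section \<open>From isomorphisms on degree-zero homology to path components\<close>

text \<open>Points joined in \<open>T\<close> carry homologous point chains there, so injectivity on
  homology makes these chains homologous in \<open>S\<close>. The augmentation over the component of
  \<open>x\<close> in \<open>S\<close> is 1 on the first chain, hence on the second, which puts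
  \<open>y\<close> into that component.\<close>

lemma H0_iso_imp_pi0_inj:
  fixes k :: "'k::field itself"
  assumes "H0_iso k S T" "S \<subseteq> T" shows "pi0_inj S T"
  unfolding pi0_inj_def
proof (intro ballI impI)
  fix x y assume xy: "x \<in> S" "y \<in> S" "path_component T x y"
  let ?R = "\<lambda>U. fhomologous 0 (top_of_set U)" and ?p = "\<lambda>x. Poly_Mapping.single (point_simplex x) (1::'k)"
  have refl: "(?p z, ?p z) \<in> ?R S" if "z \<in> S" for z
    using that by (intro point_homologous) (simp add: path_component_refl)
  \<comment> \<open>The induced map sends the class of a point chain in \<open>S\<close> to the
    class of the same chain in \<open>T\<close>.\<close>
  have T: "?R T `` (?R S `` {?p z}) = ?R T `` {?p z}" if "z \<in> S" for z
  proof
    have trans: "trans (?R T)" using equiv_fhomologous by (rule equivE)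
    show "?R T `` (?R S `` {?p z}) \<subseteq> ?R T `` {?p z}"
      using fhomologous_mono[OF assms(2), of 0] transD[OF trans] by blast
    show "?R T `` {?p z} \<subseteq> ?R T `` (?R S `` {?p z})"
      using refl[OF that] by blast
  qed
  have mem: "?R S `` {?p z} \<in> fhomology 0 (top_of_set S)" if "z \<in> S" for z
    unfolding fhomology_def by (rule quotientI) (use refl[OF that] in \<open>simp add: fhomologous_def\<close>)
  have "?R T `` {?p x} = ?R T `` {?p y}"
    by (rule equiv_class_eq[OF equiv_fhomologous point_homologous[OF xy(3)]])
  then have "?R T `` (?R S `` {?p x}) = ?R T `` (?R S `` {?p y})"
    using T xy by simp
  moreover have "inj_on (\<lambda>h :: (((nat \<Rightarrow> real) \<Rightarrow> 'a) \<Rightarrow>\<^sub>0 'k) set. ?R T `` h) (fhomology 0 (top_of_set S))"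
    using assms(1) by (simp add: H0_iso_def bij_betw_def)
  ultimately have "?R S `` {?p x} = ?R S `` {?p y}"
    using mem[OF xy(1)] mem[OF xy(2)] by (meson inj_onD)
  then have "(?p x, ?p y) \<in> ?R S" using refl xy by blast
  from component_augmentation_homologous[OF this, of x]
  show "path_component S x y"
    using xy by (simp add: component_augmentation_single point_simplex_def standard_simplex_0_vertex
        path_component_refl split: if_splits)
qed

text \<open>The point chain at \<open>y\<close> is homologous in \<open>T\<close> to a chain
  \<open>c\<close> in \<open>S\<close>. Over the component of \<open>y\<close> its augmentation is
  1, so that of \<open>c\<close> is nonzero and some simplex of \<open>c\<close> lies in this
  component.\<close>

lemma H0_iso_imp_pi0_surj:
  fixes k :: "'k::field itself"
  assumes "H0_iso k S T" shows "pi0_surj S T"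
  unfolding pi0_surj_def
proof (intro ballI)
  fix y assume y: "y \<in> T"
  let ?R = "\<lambda>U. fhomologous 0 (top_of_set U)" and ?p = "Poly_Mapping.single (point_simplex y) (1::'k)"
  have refl: "(?p, ?p) \<in> ?R T"
    using y by (intro point_homologous) (simp add: path_component_refl)
  then have "?R T `` {?p} \<in> fhomology 0 (top_of_set T)"
    unfolding fhomology_def by (intro quotientI) (simp add: fhomologous_def)
  then obtain h where h: "h \<in> fhomology 0 (top_of_set S)" "?R T `` {?p} = ?R T `` h"
    using assms unfolding H0_iso_def bij_betw_def by blast
  then obtain c where c: "c \<in> h" "(c, ?p) \<in> ?R T"
    using refl by blast
  then have "c \<in> fchains 0 (top_of_set S)"
    using h(1) by (auto simp: fhomology_def quotient_def fhomologous_def)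
  then have sing: "singular_simplex 0 (top_of_set S) s" if "s \<in> Poly_Mapping.keys c" for s
    using that by (auto simp: fchains_def)
  from component_augmentation_homologous[OF c(2), of y]
  have "component_augmentation (path_component_set T y) c \<noteq> 0"
    using y by (simp add: component_augmentation_single point_simplex_def standard_simplex_0_vertex
        path_component_refl)
  then obtain s where "s \<in> Poly_Mapping.keys c" "path_component T y (s vertex0)"
    unfolding component_augmentation_def by (auto elim!: sum.not_neutral_contains_not_neutral split: if_splits)
  then show "\<exists>x\<in>S. path_component T y x"
    using singular_simplex_0_vertex[OF sing] by auto
qed

section \<open>Path components over unions of open sets\<close>

lemma over_UNIV [simp]: "over S f UNIV = S"
  by (simp add: over_def)

text \<open>Surjectivity over each member, the case \<open>V = V'\<close>, attaches to every point
  of \<open>T\<close> over the union a component of \<open>S\<close>; surjectivity over overlaps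
  makes it independent of the member chosen.\<close>

lemma pi0_inj_over_Union:
  fixes f :: "'a::topological_space \<Rightarrow> real"
  assumes f: "continuous_on UNIV f"
    and opn: "\<And>V. V \<in> \<V> \<Longrightarrow> open V"
    and surj: "\<And>V V'. V \<in> \<V> \<Longrightarrow> V' \<in> \<V> \<Longrightarrow> pi0_surj (over S f (V \<inter> V')) (over T f (V \<inter> V'))"
    and inj: "\<And>V. V \<in> \<V> \<Longrightarrow> pi0_inj (over S f V) (over T f V)"
    and "S \<subseteq> T"
  shows "pi0_inj (over S f (\<Union>\<V>)) (over T f (\<Union>\<V>))"
  unfolding pi0_inj_def
proof (intro ballI impI)
  let ?S = "over S f" and ?T = "over T f"
  \<comment> \<open>\<open>x\<close> is a point of \<open>S\<close> reached from \<open>y\<close>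
    inside a single member. Only its component over the union is determined by
    \<open>y\<close>.\<close>
  define rep where "rep y x \<longleftrightarrow> (\<exists>V\<in>\<V>. x \<in> ?S V \<and> path_component (?T V) y x)" for y x
  have rep_ex: "\<exists>x. x \<in> ?S V \<and> path_component (?T V) y x" if "V \<in> \<V>" "y \<in> ?T V" for y V
    using surj[OF that(1) that(1)] that by (auto simp: pi0_surj_def)
  have rep_unique: "path_component (?S (\<Union>\<V>)) x x'" if "rep y x" "rep y x'" for y x x'
  proof -
    obtain V V' where V: "V \<in> \<V>" "x \<in> ?S V" "path_component (?T V) y x"
        "V' \<in> \<V>" "x' \<in> ?S V'" "path_component (?T V') y x'"
      using \<open>rep y x\<close> \<open>rep y x'\<close> by (auto simp: rep_def)
    then have "y \<in> ?T (V \<inter> V')"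
      using path_component_mem(1)[OF V(3)] path_component_mem(1)[OF V(6)] by (simp add: over_def)
    \<comment> \<open>The point \<open>z\<close> over the overlap is compared with \<open>x\<close>
      inside \<open>V\<close> and with \<open>x'\<close> inside \<open>V'\<close>, where injectivity
      turns paths in \<open>T\<close> into paths in \<open>S\<close>.\<close>
    then obtain z where z: "z \<in> ?S (V \<inter> V')" "path_component (?T (V \<inter> V')) y z"
      using surj[OF V(1,4)] by (auto simp: pi0_surj_def)
    have "path_component (?S V) x z" "path_component (?S V') z x'"
      using inj[OF V(1)] inj[OF V(4)] V z
        path_component_of_subset[OF over_mono[OF order_refl] z(2), of V]
        path_component_of_subset[OF over_mono[OF order_refl] z(2), of V']
      by (auto simp: pi0_inj_def over_def; meson IntI path_component_sym path_component_trans vimageI)+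
    then have "path_component (?S (\<Union>\<V>)) x z" "path_component (?S (\<Union>\<V>)) z x'"
      using V(1,4) by (auto elim!: path_component_of_subset[rotated] simp: over_def)
    then show ?thesis by (rule path_component_trans)
  qed
  fix x y assume xy: "x \<in> ?S (\<Union>\<V>)" "y \<in> ?S (\<Union>\<V>)" "path_component (?T (\<Union>\<V>)) x y"
  then obtain g where g: "path g" "path_image g \<subseteq> ?T (\<Union>\<V>)" "pathstart g = x" "pathfinish g = y"
    by (auto simp: path_component_def)
  \<comment> \<open>The components attached to \<open>g s\<close> and \<open>g t\<close> agree.
    Transitivity rests on \<open>rep_unique\<close>; connectedness of the unit interval then reduces
    \<open>R 0 1\<close> to a local statement.\<close>
  define R where "R s t \<longleftrightarrow> (\<exists>u v. rep (g s) u \<and> rep (g t) v \<and> path_component (?S (\<Union>\<V>)) u v)" for s t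
  have "R 0 1"
  proof (rule connected_equivalence_relation[of "{0..1::real}"])
    show "R t s" if "R s t" for s t
      using that unfolding R_def by (meson path_component_sym)
    show "R s u" if "R s t" "R t u" for s t u
      using that unfolding R_def by (meson path_component_trans rep_unique)
    fix t :: real assume t: "t \<in> {0..1}"
    then have "g t \<in> ?T (\<Union>\<V>)" using g(2) by (auto simp: path_image_def)
    then obtain V where V: "V \<in> \<V>" "g t \<in> ?T V" by (auto simp: over_def)
    obtain u where u: "u \<in> ?S V" "path_component (?T V) (g t) u" using rep_ex[OF V] by blast
    have "continuous_on {0..1} (f \<circ> g)"
      using g(1) f unfolding path_def by (intro continuous_on_compose) (auto elim: continuous_on_subset)
    then have "openin (top_of_set {0..1}) ({0..1} \<inter> (f \<circ> g) -` V)"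
      using opn[OF V(1)] by (simp add: continuous_openin_preimage_gen)
    then obtain e where e: "e > 0" "\<And>s. s \<in> {0..1} \<Longrightarrow> dist s t < e \<Longrightarrow> f (g s) \<in> V"
      using t V(2) unfolding openin_euclidean_subtopology_iff by (force simp: over_def)
    \<comment> \<open>A convex neighbourhood of \<open>t\<close> on which the path stays over
      \<open>V\<close>: the piece of path between \<open>g s\<close> and \<open>g t\<close> lies in
      \<open>?T V\<close>, so \<open>u\<close> represents both.\<close>
    let ?N = "{0..1} \<inter> ball t e"
    have "R t s" if s: "s \<in> ?N" for s
    proof -
      have "convex ?N" by (intro convex_Int) auto
      then have seg: "closed_segment t s \<subseteq> ?N"
        using s t e(1) by (intro closed_segment_subset) auto
      have "path_connected (g ` closed_segment t s)"
        using g(1) seg unfolding path_def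
        by (intro path_connected_continuous_image) (auto elim: continuous_on_subset)
      moreover have "g ` closed_segment t s \<subseteq> ?T V"
        using seg g(2) e(2) by (force simp: over_def path_image_def dist_commute)
      ultimately have "path_component (?T V) (g s) (g t)"
        by (meson ends_in_segment image_eqI path_component_of_subset path_connected_component)
      then have "path_component (?T V) (g s) u"
        using u(2) path_component_trans by blast
      moreover have "path_component (?S (\<Union>\<V>)) u u"
        using u(1) V(1) by (intro path_component_refl) (auto simp: over_def)
      ultimately show ?thesis
        using u V(1) unfolding R_def rep_def by blast
    qed
    then show "\<exists>N. openin (top_of_set {0..1}) N \<and> t \<in> N \<and> (\<forall>s\<in>N. R t s)"
      using t e(1) by (intro exI[of _ ?N]) (auto simp: openin_open_Int)
  qed auto
  then obtain u v where uv: "rep x u" "rep y v" "path_component (?S (\<Union>\<V>)) u v"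
    using g by (auto simp: R_def pathstart_def pathfinish_def)
  \<comment> \<open>The ends of the path lie in \<open>S\<close> and represent themselves.\<close>
  have "rep z z" if "z \<in> ?S (\<Union>\<V>)" for z
    using that \<open>S \<subseteq> T\<close> by (auto simp: rep_def over_def intro!: path_component_refl)
  then show "path_component (?S (\<Union>\<V>)) x y"
    using xy(1,2) uv by (meson rep_unique path_component_trans path_component_sym)
qed

section \<open>Enlarged intervals and cover hulls\<close>

text \<open>Trades possibly infinite end points for distances. The bound can be non-strict although
  the enlargement is open, since the open set \<open>U\<close> extends beyond each of its points on
  both sides.\<close>

lemma mem_enlarge_iff:
  assumes "open_interval U" "0 \<le> \<epsilon>"
  shows "t \<in> enlarge \<epsilon> U \<longleftrightarrow> (\<exists>u\<in>U. \<bar>t - u\<bar> \<le> \<epsilon>)"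
proof -
  have U: "open U" "connected U" using assms(1) by (auto simp: open_interval_def)
  have minus: "a - ereal \<epsilon> < ereal t \<longleftrightarrow> a < ereal (t + \<epsilon>)" for a
    by (cases a) auto
  have plus: "ereal t < b + ereal \<epsilon> \<longleftrightarrow> ereal (t - \<epsilon>) < b" for b
    by (cases b) auto
  have "t \<in> enlarge \<epsilon> U \<longleftrightarrow> (\<exists>u\<in>U. u < t + \<epsilon>) \<and> (\<exists>u\<in>U. t - \<epsilon> < u)"
    by (simp add: enlarge_def einterval_def minus plus INF_less_iff less_SUP_iff)
  also have "\<dots> \<longleftrightarrow> (\<exists>u\<in>U. \<bar>t - u\<bar> \<le> \<epsilon>)"
  proof (intro iffI; elim conjE bexE)
    fix u u' assume u: "u \<in> U" "u < t + \<epsilon>" "u' \<in> U" "t - \<epsilon> < u'"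
    show "\<exists>u\<in>U. \<bar>t - u\<bar> \<le> \<epsilon>"
    proof (cases "t - \<epsilon> \<le> u")
      case False
      \<comment> \<open>Here \<open>t - \<epsilon>\<close> lies between \<open>u\<close> and
        \<open>u'\<close>, and its distance to \<open>t\<close> is exactly
        \<open>\<epsilon>\<close>.\<close>
      then have "t - \<epsilon> \<in> U" using connectedD_interval[OF U(2) u(1,3)] u by simp
      then show ?thesis using assms(2) by (intro bexI[of _ "t - \<epsilon>"]) auto
    qed (use u in force)
  next
    fix u assume u: "u \<in> U" "\<bar>t - u\<bar> \<le> \<epsilon>"
    then obtain e where "e > 0" "ball u e \<subseteq> U" using U(1) openE by blast
    then have "u - e/2 \<in> U" "u + e/2 \<in> U" "e > 0" by (auto simp: subset_iff dist_real_def)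
    with u show "(\<exists>u\<in>U. u < t + \<epsilon>) \<and> (\<exists>u\<in>U. t - \<epsilon> < u)"
      by (intro conjI bexI[of _ "u - e/2"] bexI[of _ "u + e/2"]) auto
  qed
  finally show ?thesis .
qed

lemma subset_enlarge: "open_interval U \<Longrightarrow> 0 \<le> \<epsilon> \<Longrightarrow> U \<subseteq> enlarge \<epsilon> U"
  by (force simp: mem_enlarge_iff)

lemma enlarge_mono:
  "open_interval U \<Longrightarrow> open_interval V \<Longrightarrow> U \<subseteq> V \<Longrightarrow> 0 \<le> \<epsilon> \<Longrightarrow> enlarge \<epsilon> U \<subseteq> enlarge \<epsilon> V"
  by (fastforce simp: mem_enlarge_iff)

lemma open_interval_enlarge:
  assumes "open_interval U" "0 \<le> \<epsilon>" shows "open_interval (enlarge \<epsilon> U)"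
proof -
  have "is_interval (einterval a b)" for a b
    unfolding is_interval_1 Ball_def einterval_iff by (meson ereal_less_eq(3) le_less_trans less_le_trans)
  then show ?thesis
    using subset_enlarge[OF assms] assms(1)
    by (auto simp: open_interval_def enlarge_def is_interval_connected_1)
qed

lemma enlarge_enlarge:
  assumes "open_interval U" "0 \<le> \<epsilon>"
  shows "enlarge \<epsilon> (enlarge \<epsilon> U) = enlarge (2 * \<epsilon>) U"
proof (intro equalityI subsetI)
  fix t assume "t \<in> enlarge \<epsilon> (enlarge \<epsilon> U)"
  then obtain u v where "u \<in> U" "\<bar>v - u\<bar> \<le> \<epsilon>" "\<bar>t - v\<bar> \<le> \<epsilon>"
    using assms by (auto simp: mem_enlarge_iff open_interval_enlarge)
  then show "t \<in> enlarge (2 * \<epsilon>) U"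
    using assms by (auto simp: mem_enlarge_iff intro!: bexI[of _ u])
next
  fix t assume "t \<in> enlarge (2 * \<epsilon>) U"
  then obtain u where u: "u \<in> U" "\<bar>t - u\<bar> \<le> 2 * \<epsilon>"
    using assms by (auto simp: mem_enlarge_iff)
  \<comment> \<open>The midpoint is within \<open>\<epsilon>\<close> of both \<open>t\<close> and
    \<open>u\<close>.\<close>
  have "(t + u) / 2 \<in> enlarge \<epsilon> U"
    using assms u by (auto simp: mem_enlarge_iff intro!: bexI[of _ u])
  then show "t \<in> enlarge \<epsilon> (enlarge \<epsilon> U)"
    using assms u
    by (intro mem_enlarge_iff[OF open_interval_enlarge[OF assms] assms(2), THEN iffD2]
        bexI[of _ "(t + u) / 2"]) (auto simp: abs_le_iff field_simps)
qed

section \<open>Cover hulls compared with enlargements\<close>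

lemma subset_cover_hull: "U \<subseteq> cover_hull \<U> U"
  by (auto simp: cover_hull_def)

lemma cover_hull_subset_enlarge:
  assumes "nice_cover \<U>" "open_interval U" "0 \<le> \<epsilon>" "cover_resolution f S \<U> \<le> ennreal \<epsilon>"
  shows "over S f (cover_hull \<U> U) \<subseteq> over S f (enlarge \<epsilon> U)"
proof
  fix s assume s: "s \<in> over S f (cover_hull \<U> U)"
  then obtain x where x: "x \<in> U" "f s \<in> \<Inter>{V \<in> \<U>. x \<in> V}" "s \<in> S"
    unfolding over_def cover_hull_def by blast
  have "x \<in> \<Union>\<U>" using assms(1) by (simp add: nice_cover_def)
  then obtain V where V: "V \<in> \<U>" "x \<in> V" by blast
  then have fs: "f s \<in> V" using x by auto
  have "ennreal (dist (f s) x) \<le> ediam V"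
    unfolding ediam_def by (rule SUP_upper2[OF fs SUP_upper[OF V(2)]])
  also have "\<dots> \<le> cover_resolution f S \<U>"
    unfolding cover_resolution_def by (rule SUP_upper) (use V fs x in auto)
  also note assms(4)
  finally have "\<bar>f s - x\<bar> \<le> \<epsilon>" using assms(3) by (simp add: dist_real_def)
  then show "s \<in> over S f (enlarge \<epsilon> U)"
    using x assms by (auto simp: over_def mem_enlarge_iff)
qed

section \<open>The interleaving\<close>

text \<open>By \<open>image\<close>, every element of either cosheaf is the component of a point of
  \<open>S\<close>. All maps involved send the component of \<open>s\<close> to the component of
  \<open>s\<close>, so naturality and both composition laws follow by evaluating at such
  points.\<close>

lemma interleaved_image_reeb:
  fixes f :: "'a::topological_space \<Rightarrow> real" and \<U> :: "real set set"
  defines "I \<equiv> cover_hull \<U>"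
  assumes "S \<subseteq> B" "A \<subseteq> B" "0 \<le> \<epsilon>"
    and inj: "\<And>U. open_interval U \<Longrightarrow> pi0_inj (over S f (I U)) (over B f (I U))"
    and image: "\<And>U. open_interval U \<Longrightarrow>
      path_component_set (over B f (I U)) ` over A f (I U) = path_component_set (over B f (I U)) ` over S f (I U)"
    and hull: "\<And>U. open_interval U \<Longrightarrow> over S f (I U) \<subseteq> over S f (enlarge \<epsilon> U)"
  shows "interleaved \<epsilon> (image_cosheaf A B f \<U>) (reeb_cosheaf S f)"
proof -
  let ?F = "image_cosheaf A B f \<U>" and ?G = "reeb_cosheaf S f" and ?E = "enlarge \<epsilon>"
  let ?cB = "\<lambda>U. path_component_set (over B f (I U))" and ?cS = "\<lambda>U. path_component_set (over S f U)"
  \<comment> \<open>By \<open>inj\<close>, a component of \<open>B\<close> over the hull meets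
    \<open>S\<close> in a single component, which \<open>hull\<close> allows to be pushed into the
    enlargement. In the other direction, \<open>\<psi>\<close> is inclusion along
    \<open>U \<subseteq> ?E U \<subseteq> I (?E U)\<close>.\<close>
  define \<phi> where "\<phi> U c = pi0_incl (over S f (?E U)) (c \<inter> over S f (I U))" for U c
  define \<psi> where "\<psi> U = pi0_incl (over B f (I (?E U)))" for U
  have I: "U \<subseteq> V \<Longrightarrow> I U \<subseteq> I V" "U \<subseteq> I U" for U V
    unfolding I_def by (simp_all add: cover_hull_mono subset_cover_hull)
  have SB: "U \<subseteq> V \<Longrightarrow> s \<in> over S f U \<Longrightarrow> s \<in> over B f V" for U V s
    using over_mono[OF \<open>S \<subseteq> B\<close>, of U V f] by blast
  have obF: "ob ?F U = ?cB U ` over S f (I U)" if "open_interval U" for U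
    using image[OF that] pi0_incl_image[OF over_mono[OF \<open>A \<subseteq> B\<close> order_refl], of f "I U"]
    by (simp add: image_cosheaf_def I_def)
  have obG: "ob ?G U = ?cS U ` over S f U" for U
    by (simp add: reeb_cosheaf_def pi0_def)
  have morF: "mor ?F U V (?cB U s) = ?cB V s" if "U \<subseteq> V" "s \<in> over S f (I U)" for U V s
    using pi0_incl_component[OF over_mono[OF order_refl I(1)[OF that(1)]], of s B f] SB[OF order_refl that(2)]
    by (simp add: image_cosheaf_def I_def)
  have morG: "mor ?G U V (?cS U s) = ?cS V s" if "U \<subseteq> V" "s \<in> over S f U" for U V s
    using pi0_incl_component[OF over_mono[OF order_refl that(1)] that(2)]
    by (simp add: reeb_cosheaf_def)
  have phi: "\<phi> U (?cB U s) = ?cS (?E U) s" if "open_interval U" "s \<in> over S f (I U)" for U s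
  proof -
    have "over S f (I U) \<subseteq> over B f (I U)" using over_mono[OF \<open>S \<subseteq> B\<close>] by blast
    then have "?cB U s \<inter> over S f (I U) = ?cS (I U) s"
      using inj[OF that(1)] that(2) path_component_subset[of "over S f (I U)" s]
      by (auto simp: pi0_inj_def intro: path_component_of_subset)
    then show ?thesis
      using pi0_incl_component[OF hull[OF that(1)] that(2)] by (simp add: \<phi>_def)
  qed
  have psi: "\<psi> U (?cS U s) = ?cB (?E U) s" if "open_interval U" "s \<in> over S f U" for U s
    unfolding \<psi>_def using subset_enlarge[OF that(1) \<open>0 \<le> \<epsilon>\<close>] I(2)[of "?E U"]
    by (intro pi0_incl_component over_mono \<open>S \<subseteq> B\<close> that(2)) auto
  have E: "open_interval (?E U)" "U \<subseteq> ?E U" "U \<subseteq> enlarge (2 * \<epsilon>) U" "?E (?E U) = enlarge (2 * \<epsilon>) U"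
    if "open_interval U" for U
    using that \<open>0 \<le> \<epsilon>\<close> by (simp_all add: open_interval_enlarge subset_enlarge enlarge_enlarge)
  have sub: "s \<in> over S f V" if "s \<in> over S f U" "U \<subseteq> V" for s U V
    using that by (auto simp: over_def)
  have hull': "s \<in> over S f (?E U)" if "open_interval U" "s \<in> over S f (I U)" for s U
    using hull that by blast
  show ?thesis
    unfolding interleaved_def
  proof (rule exI[of _ \<phi>], rule exI[of _ \<psi>], intro conjI allI impI ballI Pi_I)
    fix U c assume U: "open_interval U"
    show "\<phi> U c \<in> ob ?G (?E U)" if "c \<in> ob ?F U"
      using that U by (auto simp: obF obG phi hull')
    show "\<psi> U c \<in> ob ?F (?E U)" if "c \<in> ob ?G U"
      using that U E[OF U] sub[OF _ order_trans[OF E(2)[OF U] I(2)]] by (auto simp: obF obG psi)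
    show "\<psi> (?E U) (\<phi> U c) = mor ?F U (enlarge (2 * \<epsilon>) U) c" if "c \<in> ob ?F U"
      using that U E[OF U] by (auto simp: obF phi psi hull' morF)
    show "\<phi> (?E U) (\<psi> U c) = mor ?G U (enlarge (2 * \<epsilon>) U) c" if "c \<in> ob ?G U"
      using that U E[OF U] sub[OF _ order_trans[OF E(2)[OF U] I(2)]]
      by (auto simp: obG phi psi morG)
  next
    fix U V c assume U: "open_interval U" "open_interval V" "U \<subseteq> V"
    have EUV: "?E U \<subseteq> ?E V" using U \<open>0 \<le> \<epsilon>\<close> by (rule enlarge_mono)
    show "\<phi> V (mor ?F U V c) = mor ?G (?E U) (?E V) (\<phi> U c)" if "c \<in> ob ?F U"
      using that U EUV sub[OF _ I(1)[OF U(3)]] by (auto simp: obF phi hull' morF morG)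
    show "\<psi> V (mor ?G U V c) = mor ?F (?E U) (?E V) (\<psi> U c)" if "c \<in> ob ?G U"
      using that U EUV sub[OF _ U(3)] sub[OF _ order_trans[OF E(2)[OF U(1)] I(2)]]
      by (auto simp: obG psi morF morG)
  qed
qed

section \<open>Cover hulls as unions of local intersections\<close>

text \<open>Openness comes from the finiteness of the family at \<open>x\<close>. The overlap in the
  third claim is the intersection of the union of two families, possibly empty; gluing asks for
  surjectivity over such overlaps.\<close>

lemma nice_cover_local_intersection:
  assumes "nice_cover \<U>"
  shows "open (\<Inter>{V \<in> \<U>. x \<in> V})" "\<Inter>{V \<in> \<U>. x \<in> V} \<in> cover_intersections \<U>"
    "\<Inter>{V \<in> \<U>. x \<in> V} \<inter> \<Inter>{V \<in> \<U>. y \<in> V} \<in> cover_intersections \<U>"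
proof -
  show "open (\<Inter>{V \<in> \<U>. x \<in> V})"
    using assms by (intro open_Inter) (auto simp: nice_cover_def open_interval_def)
  have "x \<in> \<Union>\<U>" using assms by (simp add: nice_cover_def)
  then have ne: "{V \<in> \<U>. x \<in> V} \<noteq> {}" by blast
  then show "\<Inter>{V \<in> \<U>. x \<in> V} \<in> cover_intersections \<U>"
    unfolding cover_intersections_def by blast
  have "\<Inter>{V \<in> \<U>. x \<in> V} \<inter> \<Inter>{V \<in> \<U>. y \<in> V} = \<Inter>({V \<in> \<U>. x \<in> V} \<union> {V \<in> \<U>. y \<in> V})"
    by blast
  with ne show "\<Inter>{V \<in> \<U>. x \<in> V} \<inter> \<Inter>{V \<in> \<U>. y \<in> V} \<in> cover_intersections \<U>"
    unfolding cover_intersections_def by (intro CollectI exI[of _ "{V \<in> \<U>. x \<in> V} \<union> {V \<in> \<U>. y \<in> V}"]) blast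
qed

lemma pi0_inj_over_cover_hull:
  fixes f :: "'a::topological_space \<Rightarrow> real"
  assumes "continuous_on UNIV f" "nice_cover \<U>" "S \<subseteq> T"
    and "\<And>V. V \<in> cover_intersections \<U> \<Longrightarrow> pi0_surj (over S f V) (over T f V)"
    and "\<And>V. V \<in> cover_intersections \<U> \<Longrightarrow> pi0_inj (over S f V) (over T f V)"
  shows "pi0_inj (over S f (cover_hull \<U> U)) (over T f (cover_hull \<U> U))"
proof -
  have "cover_hull \<U> U = \<Union>((\<lambda>x. \<Inter>{V \<in> \<U>. x \<in> V}) ` U)"
    by (simp add: cover_hull_def)
  moreover have "pi0_inj (over S f (\<Union>((\<lambda>x. \<Inter>{V \<in> \<U>. x \<in> V}) ` U))) (over T f (\<Union>((\<lambda>x. \<Inter>{V \<in> \<U>. x \<in> V}) ` U)))"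
    using assms(1,3) nice_cover_local_intersection[OF assms(2)] assms(4,5)
    by (intro pi0_inj_over_Union) auto
  ultimately show ?thesis by simp
qed

text \<open>Injectivity of \<open>S \<rightarrow> B\<close> over a hull is obtained in two steps through \<open>D2\<close>: local
  surjectivity, needed to pass from the cover to the hull, may fail for \<open>S \<rightarrow> B\<close> and for
  \<open>D2 \<rightarrow> B\<close>, but holds for \<open>S \<rightarrow> T2\<close> and \<open>D2 \<rightarrow> D2'\<close>.\<close>

lemma interleaved_sandwich:
  fixes f :: "'a::topological_space \<Rightarrow> real"
  assumes f: "continuous_on UNIV f" and \<U>: "nice_cover \<U>"
    and \<epsilon>: "0 \<le> \<epsilon>" "cover_resolution f S \<U> \<le> ennreal \<epsilon>"
    and sub: "S \<subseteq> D1" "D1' \<subseteq> A" "A \<subseteq> D1" "D1 \<subseteq> T1" "T1 \<subseteq> D2" "D2 \<subseteq> T2" "D2 \<subseteq> B" "B \<subseteq> D2'"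
    and surj: "\<And>V. V \<in> cover_intersections \<U> \<Longrightarrow>
        pi0_surj (over D1' f V) (over D1 f V) \<and> pi0_surj (over S f V) (over T1 f V) \<and>
        pi0_surj (over S f V) (over T2 f V) \<and> pi0_surj (over D2 f V) (over D2' f V)"
    and inj: "\<And>V. V \<in> cover_intersections \<U> \<Longrightarrow>
        pi0_inj (over S f V) (over T2 f V) \<and> pi0_inj (over D2 f V) (over D2' f V)"
  shows "interleaved \<epsilon> (image_cosheaf A B f \<U>) (reeb_cosheaf S f)"
proof (rule interleaved_image_reeb)
  show "S \<subseteq> B" "A \<subseteq> B" "0 \<le> \<epsilon>" using sub \<epsilon> by auto
  fix U assume U: "open_interval U"
  let ?I = "cover_hull \<U> U"
  show "over S f ?I \<subseteq> over S f (enlarge \<epsilon> U)"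
    using \<U> U \<epsilon> by (rule cover_hull_subset_enlarge)
  have "pi0_inj (over S f ?I) (over T2 f ?I)"
    using f \<U> surj inj sub by (intro pi0_inj_over_cover_hull) auto
  then have "pi0_inj (over S f ?I) (over D2 f ?I)"
    by (rule pi0_inj_subset[OF _ over_mono[OF sub(6) order_refl]])
  moreover have "pi0_inj (over D2 f ?I) (over D2' f ?I)"
    using f \<U> surj inj sub by (intro pi0_inj_over_cover_hull) auto
  then have "pi0_inj (over D2 f ?I) (over B f ?I)"
    by (rule pi0_inj_subset[OF _ over_mono[OF sub(8) order_refl]])
  ultimately show "pi0_inj (over S f ?I) (over B f ?I)"
    using sub pi0_inj_trans[OF _ _ over_mono[OF _ order_refl]] by blast
  \<comment> \<open>Surjectivity is local: a point of \<open>P\<close> over the hull lies over one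
    local intersection, where it is joined within \<open>T1 \<subseteq> B\<close> to a point of
    \<open>Q\<close>. Applied with \<open>A\<close> and \<open>S\<close> in both orders.\<close>
  have lift: "path_component_set (over B f ?I) ` over P f ?I \<subseteq> path_component_set (over B f ?I) ` over Q f ?I"
    if "P \<subseteq> T1" and Q: "\<And>V. V \<in> cover_intersections \<U> \<Longrightarrow> pi0_surj (over Q f V) (over T1 f V)" for P Q
  proof
    fix c assume "c \<in> path_component_set (over B f ?I) ` over P f ?I"
    then obtain y x where y: "c = path_component_set (over B f ?I) y" "y \<in> P"
        "x \<in> U" "f y \<in> \<Inter>{V \<in> \<U>. x \<in> V}"
      unfolding over_def cover_hull_def by blast
    define V where "V = \<Inter>{V \<in> \<U>. x \<in> V}"
    have "V \<in> cover_intersections \<U>"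
      unfolding V_def by (rule nice_cover_local_intersection[OF \<U>])
    then have "pi0_surj (over Q f V) (over T1 f V)" by (rule Q)
    moreover have "y \<in> over T1 f V"
      using y \<open>P \<subseteq> T1\<close> unfolding over_def V_def by blast
    ultimately obtain z where z: "z \<in> over Q f V" "path_component (over T1 f V) y z"
      unfolding pi0_surj_def by blast
    have "V \<subseteq> ?I"
      using y by (auto simp: V_def cover_hull_def)
    have "over T1 f V \<subseteq> over B f ?I" "over Q f V \<subseteq> over Q f ?I"
      using sub \<open>V \<subseteq> ?I\<close> by (auto simp: over_def)
    then have "path_component (over B f ?I) y z" "z \<in> over Q f ?I"
      using z path_component_of_subset by blast+
    then show "c \<in> path_component_set (over B f ?I) ` over Q f ?I"
      using y(1) path_component_eq by blast
  qed
  \<comment> \<open>Factor through \<open>D1\<close>: enlarging the source preserves surjectivity,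
    from \<open>D1'\<close> to \<open>A\<close> and from \<open>S\<close> to
    \<open>D1\<close>.\<close>
  have "pi0_surj (over A f V) (over T1 f V)" if V: "V \<in> cover_intersections \<U>" for V
  proof -
    have "pi0_surj (over D1 f V) (over T1 f V)"
      using surj[OF V] over_mono[OF sub(1) order_refl, of f V] unfolding pi0_surj_def by blast
    moreover have "pi0_surj (over A f V) (over D1 f V)"
      using surj[OF V] over_mono[OF sub(2) order_refl, of f V] unfolding pi0_surj_def by blast
    ultimately show ?thesis
      using pi0_surj_trans over_mono[OF sub(4) order_refl] by blast
  qed
  then show "path_component_set (over B f ?I) ` over A f ?I = path_component_set (over B f ?I) ` over S f ?I"
    using surj sub by (intro equalityI lift) auto
qed

text \<open>An infinite bound is trivial, and a finite one is itself an admissible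
  \<open>\<epsilon>\<close>.\<close>

lemma interleaving_dist_le:
  assumes "\<And>\<epsilon>. 0 \<le> \<epsilon> \<Longrightarrow> c = ennreal \<epsilon> \<Longrightarrow> interleaved \<epsilon> F G"
  shows "interleaving_dist F G \<le> c"
proof (cases c)
  case (real \<epsilon>)
  then show ?thesis
    unfolding interleaving_dist_def by (intro INF_lower2[of \<epsilon>]) (use assms in auto)
qed simp

section \<open>Thickenings and regular values\<close>

lemma subset_thickening: "S \<subseteq> thickening S \<delta>"
  by (auto simp: thickening_def intro!: INF_lower2)

text \<open>Some \<open>\<delta>'\<close> beyond \<open>\<delta>\<close> occurs in the supremum for
  \<open>V\<close>, and membership there covers all thickenings up to
  \<open>\<delta>'\<close>.\<close>

lemma H0_iso_thickening:
  assumes "ennreal \<delta> < cover_crit_value k S f \<U>" "V \<in> cover_intersections \<U>" "0 \<le> \<delta>"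
  shows "H0_iso k (over S f V) (over (thickening S \<delta>) f V)"
proof -
  have "ennreal \<delta> < crit_value k S f V"
    using assms(1,2) unfolding cover_crit_value_def by (meson INF_lower less_le_trans)
  then obtain \<delta>' where "ennreal \<delta> < ennreal \<delta>'" "0 \<le> \<delta>'"
      "\<forall>\<delta>''. 0 \<le> \<delta>'' \<and> \<delta>'' \<le> \<delta>' \<longrightarrow> H0_iso k (over S f V) (over (thickening S \<delta>'') f V)"
    unfolding crit_value_def less_SUP_iff by blast
  then show ?thesis using assms(3) by (auto simp: ennreal_less_iff)
qed

lemma superlevel_antimono: "L \<le> L' \<Longrightarrow> superlevel p L' \<subseteq> superlevel p L"
  by (auto simp: superlevel_def)

lemma regularity_range_H0_iso:
  assumes "regularity_range k p f V L \<nu>" "{L - e, L + e} \<subseteq> {L - \<nu><..<L + \<nu>}" "0 < e"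
  shows "H0_iso k (over (superlevel p (L + e)) f V) (over (superlevel p L) f V)"
    "H0_iso k (over (superlevel p L) f V) (over (superlevel p (L - e)) f V)"
  using assms by (auto simp: regularity_range_def)

section \<open>High-probability events\<close>

lemma inner_prob_le_1: "prob_space M \<Longrightarrow> inner_prob M A \<le> 1"
  unfolding inner_prob_def
  by (rule cSUP_least) (auto intro: prob_space.prob_le_1)

text \<open>For measurable subsets of \<open>A\<close> and \<open>B\<close> this is
  inclusion-exclusion with the union of measure at most 1. The suprema over the two subsets are then
  taken one after the other.\<close>

lemma inner_prob_Int_ge:
  assumes "prob_space M" "A \<inter> B \<subseteq> C"
  shows "inner_prob M A + inner_prob M B - 1 \<le> inner_prob M C"
proof -
  interpret prob_space M by fact
  have "measure M A' + measure M B' - 1 \<le> inner_prob M C"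
    if "A' \<in> sets M" "A' \<subseteq> A" "B' \<in> sets M" "B' \<subseteq> B" for A' B'
  proof -
    have "measure M A' + measure M B' = measure M (A' \<union> B') + measure M (A' \<inter> B')"
      using that by (simp add: measure_Un3 fmeasurable_eq_sets)
    then have "measure M A' + measure M B' - 1 \<le> measure M (A' \<inter> B')"
      using prob_le_1[of "A' \<union> B'"] by linarith
    also have "\<dots> \<le> inner_prob M C"
      unfolding inner_prob_def using that assms(2)
      by (intro cSUP_upper bdd_aboveI[of _ 1]) (auto intro: prob_le_1)
    finally show ?thesis .
  qed
  then have "measure M A' \<le> inner_prob M C + 1 - measure M B'"
    if "A' \<in> sets M" "A' \<subseteq> A" "B' \<in> sets M" "B' \<subseteq> B" for A' B'
    using that by (simp add: algebra_simps)
  then have "inner_prob M A \<le> inner_prob M C + 1 - measure M B'" if "B' \<in> sets M" "B' \<subseteq> B" for B'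
    unfolding inner_prob_def[of M A] using that by (intro cSUP_least) auto
  then have "measure M B' \<le> inner_prob M C + 1 - inner_prob M A" if "B' \<in> sets M" "B' \<subseteq> B" for B'
    using that by (simp add: algebra_simps)
  then have "inner_prob M B \<le> inner_prob M C + 1 - inner_prob M A"
    unfolding inner_prob_def[of M B] by (intro cSUP_least) auto
  then show ?thesis by simp
qed

lemma whp_conj_mono:
  assumes "prob_space M" "whp M P" "whp M Q" "\<And>n \<omega>. P n \<omega> \<Longrightarrow> Q n \<omega> \<Longrightarrow> R n \<omega>"
  shows "whp M R"
  unfolding whp_def
proof (rule tendsto_sandwich)
  let ?p = "\<lambda>P n. inner_prob M {\<omega> \<in> space M. P n \<omega>}"
  show "\<forall>\<^sub>F n in sequentially. ?p P n + ?p Q n - 1 \<le> ?p R n"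
    using assms(4) by (intro always_eventually allI inner_prob_Int_ge[OF assms(1)]) auto
  show "\<forall>\<^sub>F n in sequentially. ?p R n \<le> 1"
    by (simp add: inner_prob_le_1 assms(1))
  have "(\<lambda>n. ?p P n + ?p Q n - 1) \<longlonglongrightarrow> 1 + 1 - 1"
    using assms(2,3) unfolding whp_def by (intro tendsto_intros)
  then show "(\<lambda>n. ?p P n + ?p Q n - 1) \<longlonglongrightarrow> 1" by simp
qed simp

text \<open>Choosing the whole line for \<open>V\<close> yields global inclusions, which restrict to
  every \<open>V\<close>; a single event thus serves all hulls at once.\<close>

lemma bandwidth_constantD:
  fixes p :: "'a::euclidean_space \<Rightarrow> real"
  assumes "bandwidth_constant M X p f K r L \<epsilon> C"
    and "\<forall>\<^sub>F n in sequentially. c * ln (real n) \<le> real n * r n ^ DIM('a)" "C \<le> c"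
  shows "whp M (\<lambda>n \<omega>.
    superlevel p (L + 2 * \<epsilon>) \<subseteq> superlevel_est K n (r n) (\<lambda>i. X i \<omega>) (L + \<epsilon>) \<and>
    superlevel_est K n (r n) (\<lambda>i. X i \<omega>) (L + \<epsilon>) \<subseteq> superlevel p L \<and>
    superlevel p L \<subseteq> superlevel_est K n (r n) (\<lambda>i. X i \<omega>) (L - \<epsilon>) \<and>
    superlevel_est K n (r n) (\<lambda>i. X i \<omega>) (L - \<epsilon>) \<subseteq> superlevel p (L - 2 * \<epsilon>))"
proof -
  have "\<forall>\<^sub>F n in sequentially. C * ln (real n) \<le> real n * r n ^ DIM('a)"
    using assms(2) eventually_gt_at_top[of 0]
  proof eventually_elim
    case (elim n)
    then have "C * ln (real n) \<le> c * ln (real n)" using assms(3) by (intro mult_right_mono) auto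
    then show ?case using elim by linarith
  qed
  with assms(1) have "whp M (\<lambda>n \<omega>.
      let D = (\<lambda>e. over (superlevel p e) f UNIV);
          D_est = (\<lambda>e. over (superlevel_est K n (r n) (\<lambda>i. X i \<omega>) e) f UNIV)
      in D (L + 2 * \<epsilon>) \<subseteq> D_est (L + \<epsilon>) \<and> D_est (L + \<epsilon>) \<subseteq> D L \<and>
         D L \<subseteq> D_est (L - \<epsilon>) \<and> D_est (L - \<epsilon>) \<subseteq> D (L - 2 * \<epsilon>))"
    unfolding bandwidth_constant_def using open_UNIV by (elim conjE impE allE[of _ UNIV]) assumption+
  then show ?thesis by (simp add: Let_def)
qed

theorem theorem4p2:
  fixes S :: "(real ^ 'd) set"
    and f p K :: "real ^ 'd \<Rightarrow> real"
    and m :: nat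
    and a :: "nat \<Rightarrow> real"
    and VV EE :: "nat \<Rightarrow> 's topology"
    and lf rt :: "nat \<Rightarrow> 's \<Rightarrow> 's"
    and \<U> :: "real set set"
    and k :: "'k::field itself"
    and L1 L2 \<delta>1 \<delta>2 \<epsilon>1 \<epsilon>2 :: real
    and M :: "'w measure"
    and X :: "nat \<Rightarrow> 'w \<Rightarrow> real ^ 'd"
    and r :: "nat \<Rightarrow> real"
    and C :: "real \<Rightarrow> real"
  assumes "compact S" and "locally path_connected S"
    and "continuous_on UNIV f"
    and "constructible S f m a VV EE lf rt"
    and "nice_cover \<U>"
    and "prob_density p" and "tame k p f"
    and "0 < cover_crit_value k S f \<U>"
    and "\<exists>\<epsilon>\<ge>0. ennreal \<epsilon> < cover_crit_value k S f \<U> \<and> concentrated p S \<epsilon>"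
    and "S \<subseteq> superlevel p L1" and "superlevel p L1 \<subseteq> thickening S \<delta>1"
    and "thickening S \<delta>1 \<subseteq> superlevel p L2" and "superlevel p L2 \<subseteq> thickening S \<delta>2"
    and "0 < \<delta>1" and "\<delta>1 < \<delta>2" and "ennreal \<delta>2 < cover_crit_value k S f \<U>"
    and "\<forall>V\<in>cover_intersections \<U>. regular_value k p f V L1 \<and> regular_value k p f V L2"
    and "0 < \<epsilon>1" and "0 < \<epsilon>2"
    and "\<forall>V\<in>cover_intersections \<U>. \<exists>\<nu>. regularity_range k p f V L1 \<nu> \<and>
           {L1 - 2 * \<epsilon>1, L1 + 2 * \<epsilon>1} \<subseteq> {L1 - \<nu><..<L1 + \<nu>}"
    and "\<forall>V\<in>cover_intersections \<U>. \<exists>\<nu>. regularity_range k p f V L2 \<nu> \<and>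
           {L2 - 2 * \<epsilon>2, L2 + 2 * \<epsilon>2} \<subseteq> {L2 - \<nu><..<L2 + \<nu>}"
    and "L1 - 2 * \<epsilon>1 > L2 + 2 * \<epsilon>2"
    and "prob_space M"
    and "prob_space.indep_vars M (\<lambda>_. borel) X UNIV"
    and "\<forall>i. distributed M lborel (X i) (\<lambda>x. ennreal (p x))"
    and "kernel_function K"
    and "\<forall>n. 0 < r n"
    and "bandwidth_constant M X p f K r L1 \<epsilon>1 (C \<epsilon>1)"
    and "bandwidth_constant M X p f K r L2 \<epsilon>2 (C \<epsilon>2)"
    and "\<forall>\<^sub>F n in sequentially.
           max (C \<epsilon>1) (C \<epsilon>2) * ln (real n) \<le> real n * r n ^ CARD('d)"
  shows "(\<lambda>n. inner_prob M {\<omega>\<in>space M.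
            interleaving_dist
              (image_cosheaf
                 (superlevel_est K n (r n) (\<lambda>i. X i \<omega>) (L1 + \<epsilon>1))
                 (superlevel_est K n (r n) (\<lambda>i. X i \<omega>) (L2 - \<epsilon>2)) f \<U>)
              (reeb_cosheaf S f)
            \<le> cover_resolution f S \<U>}) \<longlonglongrightarrow> 1"
proof -
  let ?D = "superlevel p" and ?E = "\<lambda>n \<omega>. superlevel_est K n (r n) (\<lambda>i. X i \<omega>)"
  have w1: "whp M (\<lambda>n \<omega>.
      ?D (L1 + 2 * \<epsilon>1) \<subseteq> ?E n \<omega> (L1 + \<epsilon>1) \<and> ?E n \<omega> (L1 + \<epsilon>1) \<subseteq> ?D L1 \<and>
      ?D L1 \<subseteq> ?E n \<omega> (L1 - \<epsilon>1) \<and> ?E n \<omega> (L1 - \<epsilon>1) \<subseteq> ?D (L1 - 2 * \<epsilon>1))"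
    using \<open>bandwidth_constant M X p f K r L1 \<epsilon>1 (C \<epsilon>1)\<close>
      \<open>\<forall>\<^sub>F n in sequentially. max (C \<epsilon>1) (C \<epsilon>2) * ln (real n) \<le> real n * r n ^ CARD('d)\<close>
    by (intro bandwidth_constantD[where c = "max (C \<epsilon>1) (C \<epsilon>2)"]) auto
  have w2: "whp M (\<lambda>n \<omega>.
      ?D (L2 + 2 * \<epsilon>2) \<subseteq> ?E n \<omega> (L2 + \<epsilon>2) \<and> ?E n \<omega> (L2 + \<epsilon>2) \<subseteq> ?D L2 \<and>
      ?D L2 \<subseteq> ?E n \<omega> (L2 - \<epsilon>2) \<and> ?E n \<omega> (L2 - \<epsilon>2) \<subseteq> ?D (L2 - 2 * \<epsilon>2))"
    using \<open>bandwidth_constant M X p f K r L2 \<epsilon>2 (C \<epsilon>2)\<close>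
      \<open>\<forall>\<^sub>F n in sequentially. max (C \<epsilon>1) (C \<epsilon>2) * ln (real n) \<le> real n * r n ^ CARD('d)\<close>
    by (intro bandwidth_constantD[where c = "max (C \<epsilon>1) (C \<epsilon>2)"]) auto
  have \<delta>: "ennreal \<delta>1 < cover_crit_value k S f \<U>" "ennreal \<delta>2 < cover_crit_value k S f \<U>"
      "0 \<le> \<delta>1" "0 \<le> \<delta>2"
    using \<open>0 < \<delta>1\<close> \<open>\<delta>1 < \<delta>2\<close> \<open>ennreal \<delta>2 < cover_crit_value k S f \<U>\<close>
    by (auto intro: le_less_trans[OF ennreal_leI[of \<delta>1 \<delta>2]])
  \<comment> \<open>Regularity is used above \<open>L1\<close>, for the inner estimate, and below
    \<open>L2\<close>, for the outer one. The range may vary with \<open>V\<close>, but the end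
    levels do not.\<close>
  have iso: "H0_iso k (over S f V) (over (thickening S \<delta>1) f V)"
      "H0_iso k (over S f V) (over (thickening S \<delta>2) f V)"
      "H0_iso k (over (?D (L1 + 2 * \<epsilon>1)) f V) (over (?D L1) f V)"
      "H0_iso k (over (?D L2) f V) (over (?D (L2 - 2 * \<epsilon>2)) f V)"
    if V: "V \<in> cover_intersections \<U>" for V
  proof -
    show "H0_iso k (over S f V) (over (thickening S \<delta>1) f V)"
      "H0_iso k (over S f V) (over (thickening S \<delta>2) f V)"
      using \<delta> V by (simp_all add: H0_iso_thickening)
    obtain \<nu>1 \<nu>2 where "regularity_range k p f V L1 \<nu>1" "{L1 - 2 * \<epsilon>1, L1 + 2 * \<epsilon>1} \<subseteq> {L1 - \<nu>1<..<L1 + \<nu>1}"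
        "regularity_range k p f V L2 \<nu>2" "{L2 - 2 * \<epsilon>2, L2 + 2 * \<epsilon>2} \<subseteq> {L2 - \<nu>2<..<L2 + \<nu>2}"
      using assms(20,21) V by meson
    then show "H0_iso k (over (?D (L1 + 2 * \<epsilon>1)) f V) (over (?D L1) f V)"
      "H0_iso k (over (?D L2) f V) (over (?D (L2 - 2 * \<epsilon>2)) f V)"
      using \<open>0 < \<epsilon>1\<close> \<open>0 < \<epsilon>2\<close> by (auto intro: regularity_range_H0_iso)
  qed
  have "whp M (\<lambda>n \<omega>. interleaving_dist (image_cosheaf (?E n \<omega> (L1 + \<epsilon>1)) (?E n \<omega> (L2 - \<epsilon>2)) f \<U>)
      (reeb_cosheaf S f) \<le> cover_resolution f S \<U>)"
  \<comment> \<open>All randomness is confined to \<open>w1\<close> and \<open>w2\<close>; on their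
    conjunction the interleaving is deterministic, with the resolution, when finite, as its
    parameter.\<close>
  proof (rule whp_conj_mono[OF \<open>prob_space M\<close> w1 w2], rule interleaving_dist_le)
    fix n \<omega> and \<epsilon> :: real
    assume est: "?D (L1 + 2 * \<epsilon>1) \<subseteq> ?E n \<omega> (L1 + \<epsilon>1) \<and> ?E n \<omega> (L1 + \<epsilon>1) \<subseteq> ?D L1 \<and>
        ?D L1 \<subseteq> ?E n \<omega> (L1 - \<epsilon>1) \<and> ?E n \<omega> (L1 - \<epsilon>1) \<subseteq> ?D (L1 - 2 * \<epsilon>1)"
      "?D (L2 + 2 * \<epsilon>2) \<subseteq> ?E n \<omega> (L2 + \<epsilon>2) \<and> ?E n \<omega> (L2 + \<epsilon>2) \<subseteq> ?D L2 \<and>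
        ?D L2 \<subseteq> ?E n \<omega> (L2 - \<epsilon>2) \<and> ?E n \<omega> (L2 - \<epsilon>2) \<subseteq> ?D (L2 - 2 * \<epsilon>2)"
      and \<epsilon>: "0 \<le> \<epsilon>" "cover_resolution f S \<U> = ennreal \<epsilon>"
    show "interleaved \<epsilon> (image_cosheaf (?E n \<omega> (L1 + \<epsilon>1)) (?E n \<omega> (L2 - \<epsilon>2)) f \<U>) (reeb_cosheaf S f)"
    proof (rule interleaved_sandwich[where ?D1.0 = "?D L1" and D1' = "?D (L1 + 2 * \<epsilon>1)" and ?D2.0 = "?D L2"
          and D2' = "?D (L2 - 2 * \<epsilon>2)" and ?T1.0 = "thickening S \<delta>1" and ?T2.0 = "thickening S \<delta>2"])
      show "?D (L1 + 2 * \<epsilon>1) \<subseteq> ?E n \<omega> (L1 + \<epsilon>1)" "?E n \<omega> (L1 + \<epsilon>1) \<subseteq> ?D L1"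
        "?D L2 \<subseteq> ?E n \<omega> (L2 - \<epsilon>2)" "?E n \<omega> (L2 - \<epsilon>2) \<subseteq> ?D (L2 - 2 * \<epsilon>2)"
        using est by blast+
      fix V assume V: "V \<in> cover_intersections \<U>"
      have "over (?D L2) f V \<subseteq> over (?D (L2 - 2 * \<epsilon>2)) f V"
        using \<open>0 < \<epsilon>2\<close> by (intro over_mono superlevel_antimono) auto
      moreover have "over S f V \<subseteq> over (thickening S \<delta>2) f V"
        by (intro over_mono subset_thickening order_refl)
      ultimately show "pi0_inj (over S f V) (over (thickening S \<delta>2) f V) \<and>
          pi0_inj (over (?D L2) f V) (over (?D (L2 - 2 * \<epsilon>2)) f V)"
        using iso[OF V] H0_iso_imp_pi0_inj by blast
      show "pi0_surj (over (?D (L1 + 2 * \<epsilon>1)) f V) (over (?D L1) f V) \<and>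
          pi0_surj (over S f V) (over (thickening S \<delta>1) f V) \<and>
          pi0_surj (over S f V) (over (thickening S \<delta>2) f V) \<and>
          pi0_surj (over (?D L2) f V) (over (?D (L2 - 2 * \<epsilon>2)) f V)"
        using iso[OF V] H0_iso_imp_pi0_surj by blast
    qed (use assms \<epsilon> in auto)
  qed
  then show ?thesis by (simp add: whp_def)
qed

end
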